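(* Let $n\geq 2$ be even and let $\Gamma$ be the star graph of $P_n(w)$, where $w=u\,\theta^{n/2}(u)^{-1}$ (with $u\in F_n$ a non-empty reduced word) and $w$ is not a proper power. Let $\bar{\mathcal{A}}',\bar{\mathcal{B}}',\bar{\mathcal{Q}},\bar{\mathcal{A}},\bar{\mathcal{B}}$ be the multisets associated with $u$ defined in the context. Let $d_{\bar{\mathcal{A}}}=\gcd(n,a\ (a\in\bar{\mathcal{A}}))$, $d_{\bar{\mathcal{B}}}=\gcd(n,b\ (b\in\bar{\mathcal{B}}))$, and if $u$ is not alternating let $q_0\in\bar{\mathcal{Q}}$ and set $d=\gcd(n,\ a\ (a\in\bar{\mathcal{A}}),\ b\ (b\in\bar{\mathcal{B}}),\ q-q_0\ (q\in\bar{\mathcal{Q}}))$. Then $\Gamma$ is $l(u)$-regular and has vertices $x_i,x_i^{-1}$ ($0\leq i<n$) and edges $x_i-x_{i+a}$, $x_i^{-1}-x_{i+b}^{-1}$, $x_i-x_{i+q}^{-1}$ for all $a\in\bar{\mathcal{A}}'$, $b\in\bar{\mathcal{B}}'$, $q\in\bar{\mathcal{Q}}$, $0\leq i<n$, and edges $x_i-x_{i+a}$, $x_i^{-1}-x_{i+b}^{-1}$ for all $a\in\bar{\mathcal{A}}\backslash\bar{\mathcal{A}}'$, $b\in\bar{\mathcal{B}}\backslash\bar{\mathcal{B}}'$, $0\leq i<n/2$. (a) If $u$ is not alternating then $\Gamma$ has $d$ connected components $\Gamma_0,\ldots,\Gamma_{d-1}$, where for $0\leq j<d$ the graph $\Gamma_j$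 is the induced subgraph of $\Gamma$ with vertex set $V(\Gamma_j)=V(\Gamma_j^+)\cup V(\Gamma_j^-)$, where $\Gamma_j^+$ and $\Gamma_j^-$ are the induced subgraphs of $\Gamma$ with vertex sets \[V(\Gamma_j^+)=\{x_{j+td}\mid 0\leq t<n/d\},\qquad V(\Gamma_j^-)=\{x_{j+td+q_0}^{-1}\mid 0\leq t<n/d\}\] (subscripts mod $n$). In particular, $|V(\Gamma_j^+)|=|V(\Gamma_j^-)|=n/d$ for all $0\leq j<d$, and the subscripts of the positive (resp. negative) vertices in any component are congruent mod $d$. (b) If $u$ is alternating then $\Gamma$ has $d_{\bar{\mathcal{A}}}+d_{\bar{\mathcal{B}}}$ connected components $\Gamma_0^+,\ldots,\Gamma_{d_{\bar{\mathcal{A}}}-1}^+,\Gamma_0^-,\ldots,\Gamma_{d_{\bar{\mathcal{B}}}-1}^-$, which are, respectively, the induced labelled subgraphs of $\Gamma$ with vertex sets \[V(\Gamma_j^+)=\{x_{j+td_{\bar{\mathcal{A}}}}\mid 0\leq t<n/d_{\bar{\mathcal{A}}}\},\qquad V(\Gamma_j^-)=\{x_{j+td_{\bar{\mathcal{B}}}}^{-1}\mid 0\leq t<n/d_{\bar{\mathcal{B}}}\}\] (subscripts mod $n$). Moreover, each component $\Gamma_j^+$ is isomorphic to the graph $\mathrm{circ}'_{n/d_{\bar{\mathcal{A}}}}(\{a/d_{\bar{\mathcal{A}}}\ (a\in\bar{\mathcal{A}})\})$ and each component $\Gamma_j^-$ is isomorphic to $\mathrm{circ}'_{n/d_{\bar{\mathcal{B}}}}(\{b/d_{\bar{\mathcal{B}}}\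 (b\in\bar{\mathcal{B}})\})$.
   Context: $F_n$ is the free group with basis $x_0,\ldots,x_{n-1}$; subscripts are taken modulo $n$; $\theta$ is the automorphism of $F_n$ with $\theta(x_i)=x_{i+1}$; $l(u)$ is the length of $u$. $P_n(w)=\langle x_0,\ldots,x_{n-1}\mid w,\theta(w),\ldots,\theta^{n-1}(w)\rangle$. A word of length at least 2 is alternating if it has no subword of the form $(x_ix_j)^{\pm1}$. Multisets: $\bar{\mathcal{A}}'=\{a\mid$ there is a subword $x_ix_{i+a}^{-1}$ of $u\}$; $\bar{\mathcal{B}}'=\{b\mid$ there is a subword $x_i^{-1}x_{i+b}$ of $u\}$; $\bar{\mathcal{Q}}=\{q\mid$ there is a subword $x_ix_{i+q}$ or $x_{i+q}^{-1}x_i^{-1}$ of $u\}$, in each case counting multiplicities. Let $\iota(u),\tau(u)$ be the initial and terminal letters of $u$ (a letter $x_i$ is positive, $x_i^{-1}$ is negative). With $\cup$ denoting multiset sum, $(\bar{\mathcal{A}},\bar{\mathcal{B}})$ equals: $(\bar{\mathcal{A}}'\cup\{n/2\},\bar{\mathcal{B}}'\cup\{n/2\})$ if $\iota(u),\tau(u)$ are both positive or both negative; $(\bar{\mathcal{A}}',\bar{\mathcal{B}}'\cup\{n/2,n/2\})$ if $\iota(u)$ is positive and $\tau(u)$ negative; $(\bar{\mathcal{A}}'\cup\{n/2,n/2\},\bar{\mathcal{B}}')$ if $\iota(u)$ is negative and $\tau(u)$ positive. The symbol $\backslash$ denotes multiset difference. (The authors note that $\bar{\mathcal{Q}}=\emptyset$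 if and only if $u$ is alternating.) Star graph: for a presentation $\langle X\mid R\rangle$ with cyclically reduced relators, let $\tilde R$ be the set of all cyclic permutations of elements of $R\cup R^{-1}$. The star graph is the undirected vertex-labelled graph with vertex set $X\cup X^{-1}$ and an edge joining $x$ and $y$ ($x,y\in X\cup X^{-1}$) for each distinct word in $\tilde R$ of the form $xy^{-1}z$, where the edges arising from the inverse pair $xy^{-1}z$ and $yx^{-1}z^{-1}$ are identified. Vertices in $X$ are positive, those in $X^{-1}$ negative. Graphs may have loops and more than one edge joining a pair of vertices. A graph $\Gamma$ is $r$-regular if $|N_\Gamma(v)|=r$ for every vertex $v$, where $N_\Gamma(v)$ is the set of neighbours of $v$. For an integer $N\geq 2$ and a (multi-)set $A\subseteq\{0,1,\ldots,N-1\}$, the circulant graph $\mathrm{circ}_N(A)$ is the graph with vertices $v_0,\ldots,v_{N-1}$ and edges $v_i-v_{i+a}$ for all $0\leq i<N$, $a\in A$ (subscripts mod $N$). The graph $\mathrm{circ}'_N(A)$ is defined to be $\mathrm{circ}_N(A)$ if $N/2\notin A$, and otherwise to be $\mathrm{circ}_N(A)$ with exactly one edge $v_i-v_{i+N/2}$ removed for each $N/2\leq i<N$.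
   Formalization: Neighbours are counted with multiplicity in "l(u)-regular"; in (b), if ι(u), τ(u) have opposite signs, circ' is claimed only up to edge multiplicity, and the exact isomorphism is with circ having |Ā\Ā'| (resp. |B̄\B̄'|) edges v_i−v_{i+N/2} removed instead of one. *)

theory Defs
  imports "HOL-Library.Multiset" "HOL-Library.Sublist" "HOL-Number_Theory.Cong"
begin

section \<open>Words and free groups\<close>

datatype 'a letter = Pos 'a | Neg 'a

type_synonym 'a word = "'a letter list"

fun linv :: "'a letter \<Rightarrow> 'a letter" where
  "linv (Pos x) = Neg x"
| "linv (Neg x) = Pos x"

fun positive :: "'a letter \<Rightarrow> bool" where
  "positive (Pos x) = True"
| "positive (Neg x) = False"

definition winv :: "'a word \<Rightarrow> 'a word" where
  "winv u = rev (map linv u)"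

definition reduced :: "'a word \<Rightarrow> bool" where
  "reduced u \<longleftrightarrow> \<not> (\<exists>a. sublist [a, linv a] u)"

definition freduce :: "'a word \<Rightarrow> 'a word" where
  "freduce u = foldr (\<lambda>a v. case v of [] \<Rightarrow> [a] | b # v' \<Rightarrow> if b = linv a then v' else a # v) u []"

text \<open>Elements of a free group are represented by their reduced words; the inverse
  of a reduced word is \<^const>\<open>winv\<close>.\<close>

definition free_grp :: "'a set \<Rightarrow> 'a word set" where
  "free_grp X = {u. reduced u \<and> (\<forall>a\<in>set u. set_letter a \<subseteq> X)}"

definition fmul :: "'a word \<Rightarrow> 'a word \<Rightarrow> 'a word" where
  "fmul u v = freduce (u @ v)"

definition fpow :: "'a word \<Rightarrow> nat \<Rightarrow> 'a word" where
  "fpow v k = (fmul v ^^ k) []"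

definition proper_power :: "'a set \<Rightarrow> 'a word \<Rightarrow> bool" where
  "proper_power X w \<longleftrightarrow> (\<exists>v\<in>free_grp X. \<exists>k\<ge>2. w = fpow v k)"

text \<open>No lower bound on the length is imposed, so words of length at most 1 count as
  alternating; thus a word is alternating iff its multiset \<open>Qbar\<close> below is empty.\<close>

definition alternating :: "'a word \<Rightarrow> bool" where
  "alternating u \<longleftrightarrow>
     \<not> (\<exists>x y. sublist [Pos x, Pos y] u \<or> sublist (winv [Pos x, Pos y]) u)"

definition theta :: "nat \<Rightarrow> nat word \<Rightarrow> nat word" where
  "theta n u = map (map_letter (\<lambda>i. (i + 1) mod n)) u"

text \<open>A presentation is a pair of a set of generators and a set of relators.\<close>

definition cyclic_pres :: "nat \<Rightarrow> nat word \<Rightarrow> nat set \<times> nat word set" where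
  "cyclic_pres n w = ({..<n}, {(theta n ^^ i) w | i. i < n})"

section \<open>Multigraphs\<close>

text \<open>Undirected graphs with loops and multiple edges, with finitely many edges. An edge
  joining \<open>x\<close> and \<open>y\<close> is the set \<open>{x, y}\<close> (a singleton for a loop), occurring
  in the multiset of edges as often as there are parallel edges.\<close>

record 'v mgraph =
  verts :: "'v set"
  edges :: "'v set multiset"

definition induced :: "'v mgraph \<Rightarrow> 'v set \<Rightarrow> 'v mgraph" where
  "induced G U = \<lparr>verts = U, edges = {#e \<in># edges G. e \<subseteq> U#}\<rparr>"

text \<open>Neighbours are counted with the multiplicity of the joining edge.\<close>

definition nbhd :: "'v mgraph \<Rightarrow> 'v \<Rightarrow> 'v multiset" where
  "nbhd G v = {# if e = {v} then v else the_elem (e - {v}). e \<in># {#e \<in># edges G. v \<in> e#} #}"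

definition regular :: "nat \<Rightarrow> 'v mgraph \<Rightarrow> bool" where
  "regular r G \<longleftrightarrow> (\<forall>v\<in>verts G. size (nbhd G v) = r)"

definition adj :: "'v mgraph \<Rightarrow> 'v \<Rightarrow> 'v \<Rightarrow> bool" where
  "adj G x y \<longleftrightarrow> {x, y} \<in># edges G"

definition components :: "'v mgraph \<Rightarrow> 'v mgraph set" where
  "components G = (\<lambda>x. induced G {y \<in> verts G. (adj G)\<^sup>*\<^sup>* x y}) ` verts G"

definition mgraph_iso :: "'v mgraph \<Rightarrow> 'w mgraph \<Rightarrow> bool" where
  "mgraph_iso G H \<longleftrightarrow>
     (\<exists>f. bij_betw f (verts G) (verts H) \<and> image_mset (image f) (edges G) = edges H)"

text \<open>The graph obtained by merging parallel edges.\<close>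

definition underlying :: "'v mgraph \<Rightarrow> 'v mgraph" where
  "underlying G = G\<lparr>edges := mset_set (set_mset (edges G))\<rparr>"

definition circ :: "nat \<Rightarrow> nat multiset \<Rightarrow> nat mgraph" where
  "circ N A = \<lparr>verts = {..<N},
     edges = (\<Sum>a\<in>#A. {# {i, (i + a) mod N}. i \<in># mset_set {..<N} #})\<rparr>"

text \<open>For even \<open>N\<close>: exactly \<open>k\<close> edges between \<open>v\<^sub>i\<close> and its antipode
  removed, for each \<open>N/2 \<le> i < N\<close>. In particular \<open>circ_del 0 N A\<close> is
  \<open>circ N A\<close>. Values of \<open>k\<close> other than \<open>1\<close> are needed for the components of star graphs
  of words \<open>u\<close> whose first and last letters have opposite signs: there either no or two
  copies of \<open>n/2\<close> are adjoined, and \<open>circ'\<close> has the right underlying graph but possibly the wrong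
  number of antipodal edges. For \<open>n = 4\<close>, \<open>u = x\<^sub>0 x\<^sub>1\<^sup>-\<^sup>1\<close> the negative components have
  two vertices and two edges, while \<open>circ' 2 {#1, 1#}\<close> has three edges.\<close>

definition circ_del :: "nat \<Rightarrow> nat \<Rightarrow> nat multiset \<Rightarrow> nat mgraph" where
  "circ_del k N A = \<lparr>verts = verts (circ N A),
     edges = edges (circ N A) -
       repeat_mset k {# {i, (i + N div 2) mod N}. i \<in># mset_set {N div 2..<N} #}\<rparr>"

definition circ' :: "nat \<Rightarrow> nat multiset \<Rightarrow> nat mgraph" where
  "circ' N A = (if even N \<and> N div 2 \<in># A then circ_del 1 N A else circ N A)"

section \<open>Star graphs\<close>

definition sym_relators :: "'a word set \<Rightarrow> 'a word set" where
  "sym_relators R = {rotate k r | k r. r \<in> R \<union> winv ` R}"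

text \<open>\<open>x y\<^sup>-\<^sup>1 z\<close> is sent to \<open>y x\<^sup>-\<^sup>1 z\<^sup>-\<^sup>1\<close>; a word \<open>a b z\<close> has
  \<open>x = a\<close> and \<open>y = b\<^sup>-\<^sup>1\<close>.\<close>

fun flip_word :: "'a word \<Rightarrow> 'a word" where
  "flip_word (a # b # z) = linv b # linv a # winv z"
| "flip_word v = v"

text \<open>The edges are the classes \<open>{v, flip_word v}\<close>. Meant for finite presentations with
  cyclically reduced relators.\<close>

definition star_graph :: "'a set \<times> 'a word set \<Rightarrow> 'a letter mgraph" where
  "star_graph P = (case P of (X, R) \<Rightarrow>
     \<lparr>verts = Pos ` X \<union> Neg ` X,
      edges = {# (\<Union>v\<in>c. {v ! 0, linv (v ! 1)}).
                 c \<in># mset_set {{v, flip_word v} | v. v \<in> sym_relators R \<and> 2 \<le> length v} #}\<rparr>)"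

section \<open>The multisets associated with \<open>u\<close>\<close>

definition sdiff :: "nat \<Rightarrow> nat \<Rightarrow> nat \<Rightarrow> nat" where
  "sdiff n j i = nat ((int j - int i) mod int n)"

definition Abar' :: "nat \<Rightarrow> nat word \<Rightarrow> nat multiset" where
  "Abar' n u = mset [sdiff n j i. (Pos i, Neg j) \<leftarrow> zip u (tl u)]"

definition Bbar' :: "nat \<Rightarrow> nat word \<Rightarrow> nat multiset" where
  "Bbar' n u = mset [sdiff n j i. (Neg i, Pos j) \<leftarrow> zip u (tl u)]"

definition Qbar :: "nat \<Rightarrow> nat word \<Rightarrow> nat multiset" where
  "Qbar n u = mset [sdiff n j i. (Pos i, Pos j) \<leftarrow> zip u (tl u)]
            + mset [sdiff n j i. (Neg j, Neg i) \<leftarrow> zip u (tl u)]"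

definition ABbar :: "nat \<Rightarrow> nat word \<Rightarrow> nat multiset \<times> nat multiset" where
  "ABbar n u =
     (if positive (hd u) \<longleftrightarrow> positive (last u)
        then (Abar' n u + {#n div 2#}, Bbar' n u + {#n div 2#})
      else if positive (hd u)
        then (Abar' n u, Bbar' n u + {#n div 2, n div 2#})
      else (Abar' n u + {#n div 2, n div 2#}, Bbar' n u))"

definition Abar :: "nat \<Rightarrow> nat word \<Rightarrow> nat multiset" where
  "Abar n u = fst (ABbar n u)"

definition Bbar :: "nat \<Rightarrow> nat word \<Rightarrow> nat multiset" where
  "Bbar n u = snd (ABbar n u)"

definition dA :: "nat \<Rightarrow> nat word \<Rightarrow> nat" where
  "dA n u = Gcd (insert n (set_mset (Abar n u)))"

definition dB :: "nat \<Rightarrow> nat word \<Rightarrow> nat" where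
  "dB n u = Gcd (insert n (set_mset (Bbar n u)))"

definition dQ :: "nat \<Rightarrow> nat word \<Rightarrow> nat \<Rightarrow> nat" where
  "dQ n u q0 = nat (Gcd (insert (int n)
     (int ` set_mset (Abar n u) \<union> int ` set_mset (Bbar n u)
      \<union> (\<lambda>q. int q - int q0) ` set_mset (Qbar n u))))"

definition Vpos :: "nat \<Rightarrow> nat \<Rightarrow> nat \<Rightarrow> nat letter set" where
  "Vpos n d j = {Pos ((j + t * d) mod n) | t. t < n div d}"

definition Vneg :: "nat \<Rightarrow> nat \<Rightarrow> nat \<Rightarrow> nat letter set" where
  "Vneg n d j = {Neg ((j + t * d) mod n) | t. t < n div d}"

text \<open>The edges \<open>e i (i + s)\<close> for \<open>s\<close> in a multiset of shifts and \<open>0 \<le> i < m\<close>,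
  subscripts modulo \<open>n\<close>.\<close>

definition shift_edges ::
  "nat \<Rightarrow> nat \<Rightarrow> nat multiset \<Rightarrow> (nat \<Rightarrow> nat \<Rightarrow> nat letter set) \<Rightarrow> nat letter set multiset" where
  "shift_edges n m S e = (\<Sum>s\<in>#S. {# e i ((i + s) mod n). i \<in># mset_set {..<m} #})"

end

theory Submission
  imports Defs
begin

text \<open>
  Write \<open>h = n/2\<close>, \<open>l = l(u)\<close>, \<open>L = 2l\<close>, \<open>\<rho>\<close> for rotation by one letter. The word \<open>u \<theta>\<^sup>h(u)\<^sup>-\<^sup>1\<close> is
  cyclically reduced as it stands, and \<open>w\<^sup>-\<^sup>1 = \<theta>\<^sup>h(w)\<close>, so the symmetrised relators are the
  words \<open>\<rho>\<^sup>k\<theta>\<^sup>i(w)\<close> with \<open>k < L\<close>, \<open>i < n\<close>. They are distinct: inverting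
  \<open>\<rho>\<^sup>m\<theta>\<^sup>j(w) = w\<close> gives \<open>\<rho>\<^sup>-\<^sup>m\<theta>\<^sup>j(w) = w\<close>, hence \<open>\<theta>\<^sup>2\<^sup>j(w) = w\<close> and \<open>j \<in> {0, h}\<close> modulo \<open>n\<close>; if \<open>j = h\<close>
  then \<open>w\<close> is a rotation of its inverse, which is impossible, and if \<open>j = 0\<close> then \<open>m = 0\<close>
  because \<open>w\<close> is not a proper power. The pairing \<open>x y\<^sup>-\<^sup>1 z \<leftrightarrow> y x\<^sup>-\<^sup>1 z\<^sup>-\<^sup>1\<close> sends \<open>(k, i)\<close> to \<open>(-2-k, i+h)\<close>, so
  the subwords of length two of \<open>u\<close> account for full orbits of edges, whereas the two
  self-paired positions \<open>k = l-1\<close> and \<open>k = L-1\<close> give the orbits of length \<open>h\<close> with shift \<open>h\<close>.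

  The shifts that can be realised by walks from a vertex form a subgroup of the integers,
  and the components are its cosets.
\<close>

section \<open>Reduced words and rotations\<close>

text \<open>The effect on single letters of the \<open>i\<close>-th power of \<open>theta\<close>.
  Natural subscripts suffice: modulo \<open>n\<close>, the inverse of the shift by \<open>i\<close>
  is the shift by \<open>(n - 1) * i\<close>.\<close>

definition shift :: "nat \<Rightarrow> nat \<Rightarrow> nat letter \<Rightarrow> nat letter" where
  "shift n i = map_letter (\<lambda>x. (x + i) mod n)"

lemma shift_simps [simp]:
  "shift n i (Pos x) = Pos ((x + i) mod n)" "shift n i (Neg x) = Neg ((x + i) mod n)"
  by (simp_all add: shift_def)

lemma linv_linv [simp]: "linv (linv a) = a"
  by (cases a) auto

lemma linv_neq [simp]: "linv a \<noteq> a" "a \<noteq> linv a"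
  by (cases a; simp)+

lemma linv_shift: "linv (shift n i a) = shift n i (linv a)"
  by (cases a) auto

lemma linv_eq_iff [simp]: "linv a = linv b \<longleftrightarrow> a = b"
  by (metis linv_linv)

lemma shift_shift: "shift n i (shift n j a) = shift n (i + j) a"
  by (cases a) (auto simp: mod_simps ac_simps)

lemma shift_mod: "shift n (i mod n) a = shift n i a"
  by (cases a) (auto simp: mod_simps)

lemma shift_cong: "i mod n = j mod n \<Longrightarrow> shift n i = shift n j"
  by (metis shift_mod ext)

lemma shift_0: "set_letter a \<subseteq> {..<n} \<Longrightarrow> shift n 0 a = a"
  by (cases a) auto

text \<open>Translation by \<open>i\<close> on the residues modulo \<open>n\<close> has no fixed
  point unless it is trivial, so one fixed letter already determines \<open>i\<close> modulo
  \<open>n\<close>.\<close>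

lemma shift_fixed:
  assumes "set_letter a \<subseteq> {..<n}" "shift n i a = a" shows "n dvd i"
proof -
  obtain x where "x < n" "(x + i) mod n = x"
    using assms by (cases a) auto
  then have "(x + i) mod n = (x + 0) mod n" by simp
  then have "[x + i = x + 0] (mod n)" by (simp only: cong_def)
  then have "[i = 0] (mod n)" using cong_add_lcancel_nat by blast
  then show ?thesis by (simp add: cong_0_iff)
qed

lemma theta_funpow:
  assumes "\<forall>a\<in>set u. set_letter a \<subseteq> {..<n}"
  shows "(theta n ^^ i) u = map (shift n i) u"
proof (induction i)
  case 0
  then show ?case using assms by (auto simp: shift_0 intro: map_idI[symmetric])
next
  case (Suc i)
  have "theta n v = map (shift n 1) v" for v by (simp add: theta_def shift_def)
  then show ?case using Suc by (simp add: shift_shift)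
qed

section \<open>Inverse words and reducedness\<close>

lemma winv_simps [simp]: "length (winv u) = length u" "winv (winv u) = u" "winv [] = []"
  "winv u = [] \<longleftrightarrow> u = []"
  by (auto simp: winv_def rev_map comp_def)

lemma winv_append: "winv (u @ v) = winv v @ winv u"
  by (simp add: winv_def)

lemma winv_map_shift: "winv (map (shift n i) u) = map (shift n i) (winv u)"
  by (simp add: winv_def rev_map linv_shift)

lemma hd_winv: "u \<noteq> [] \<Longrightarrow> hd (winv u) = linv (last u)"
  by (simp add: winv_def hd_rev last_map)

lemma last_winv: "u \<noteq> [] \<Longrightarrow> last (winv u) = linv (hd u)"
  by (simp add: winv_def last_rev hd_map)

lemma reduced_iff: "reduced u \<longleftrightarrow> (\<forall>u1 a u2. u \<noteq> u1 @ a # linv a # u2)"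
  by (auto simp: reduced_def sublist_def)

lemma reduced_Nil [simp]: "reduced []"
  by (simp add: reduced_iff)

lemma reduced_Cons:
  "reduced (a # v) \<longleftrightarrow> reduced v \<and> (v = [] \<or> hd v \<noteq> linv a)"
proof -
  have "sublist [b, linv b] (a # v) \<longleftrightarrow> b = a \<and> prefix [linv b] v \<or> sublist [b, linv b] v" for b
    by (auto simp: sublist_Cons_right)
  then show ?thesis unfolding reduced_def by (cases v) auto
qed

lemma reduced_append:
  "reduced (u @ v) \<longleftrightarrow> reduced u \<and> reduced v \<and> (u = [] \<or> v = [] \<or> hd v \<noteq> linv (last u))"
  by (induction u) (auto simp: reduced_Cons hd_append)

lemma reduced_winv: "reduced u \<Longrightarrow> reduced (winv u)"
proof (induction u)
  case (Cons a u)
  have "winv (a # u) = winv u @ [linv a]" by (simp add: winv_def)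
  then show ?case using Cons
    by (auto simp: reduced_append reduced_Cons last_winv)
qed auto

text \<open>Shifts are injective on letters with subscripts below \<open>n\<close> and commute with
  \<open>linv\<close>, so they create no new cancelling pair.\<close>

lemma reduced_map_shift:
  assumes "\<forall>a\<in>set u. set_letter a \<subseteq> {..<n}" "reduced u"
  shows "reduced (map (shift n i) u)"
  using assms
proof (induction u)
  case (Cons a u)
  have "shift n i (hd u) \<noteq> linv (shift n i a)" if "u \<noteq> []"
  proof
    assume "shift n i (hd u) = linv (shift n i a)"
    \<comment> \<open>Both sides are shifted back by \<open>(n - 1) * i\<close>, which is congruent
      to \<open>-i\<close> modulo \<open>n\<close>.\<close>
    then have "shift n ((n - 1) * i) (shift n i (hd u)) = shift n ((n - 1) * i) (shift n i (linv a))"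
      by (simp add: linv_shift)
    moreover have "n \<noteq> 0" using Cons.prems by (cases a) auto
    then have "(n - 1) * i + i = n * i" by (cases n) auto
    then have "shift n ((n - 1) * i + i) = shift n 0"
      by (intro shift_cong) simp
    moreover have "set_letter (hd u) \<subseteq> {..<n}" "set_letter (linv a) \<subseteq> {..<n}"
      using Cons.prems that by (cases a; auto)+
    ultimately have "hd u = linv a" by (simp add: shift_shift shift_0)
    then show False using Cons.prems that by (simp add: reduced_Cons)
  qed
  then show ?case using Cons by (auto simp: reduced_Cons hd_map)
qed auto

lemma freduce_reduced: "reduced u \<Longrightarrow> freduce u = u"
proof (induction u)
  case (Cons a u)
  then have "freduce u = u" by (simp add: reduced_Cons)
  moreover have "freduce (a # u) = (case freduce u of [] \<Rightarrow> [a] | b # v' \<Rightarrow> if b = linv a then v' else a # freduce u)"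
    unfolding freduce_def by simp
  ultimately show ?case using Cons.prems by (auto simp: reduced_Cons split: list.splits)
qed (simp add: freduce_def)

section \<open>Proper powers, self-inverse words and rotations\<close>

lemma fpow_eq_concat:
  "reduced (concat (replicate k v)) \<Longrightarrow> fpow v k = concat (replicate k v)"
  by (induction k) (auto simp: fpow_def fmul_def freduce_reduced reduced_append)

text \<open>A rotation fixing \<open>w\<close> splits it as \<open>w = x y = y x\<close>, and
  commuting words are powers of a common word \<open>z\<close>. As a factor of \<open>w\<close>, the
  root \<open>z\<close> is again reduced.\<close>

lemma proper_powerI_rotate:
  assumes "w \<in> free_grp X" "rotate m w = w" "0 < m" "m < length w"
  shows "proper_power X w"
proof -
  let ?x = "take m w" and ?y = "drop m w"
  have "?y @ ?x = w" using assms by (simp add: rotate_drop_take)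
  then have "?x @ ?y = ?y @ ?x" by simp
  then obtain i j z where z: "concat (replicate i z) = ?x" "concat (replicate j z) = ?y"
    using comm_append_are_replicate by blast
  \<comment> \<open>Since \<open>0 < m < length w\<close>, neither half is empty; this makes the
    total exponent at least 2.\<close>
  have "i \<noteq> 0" "j \<noteq> 0" using z assms by (auto intro!: Nat.gr0I)
  have w: "w = concat (replicate (i + j) z)"
    by (metis z append_take_drop_id concat_append replicate_add)
  have red: "reduced w" using assms by (simp add: free_grp_def)
  have w2: "w = z @ concat (replicate (i + j - 1) z)"
    using w \<open>i \<noteq> 0\<close> by (cases "i + j") auto
  have "reduced z" using red w2 by (metis reduced_append)
  moreover have "set z \<subseteq> set w" using w2 by (metis Un_upper1 set_append)
  ultimately have "z \<in> free_grp X"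
    using assms(1) unfolding free_grp_def by blast
  moreover have "w = fpow z (i + j)" using w red fpow_eq_concat by metis
  moreover have "i + j \<ge> 2" using \<open>i \<noteq> 0\<close> \<open>j \<noteq> 0\<close> by simp
  ultimately show ?thesis unfolding proper_power_def by blast
qed

text \<open>Letters in mirror positions are mutually inverse. In odd length the middle letter would
  be its own inverse; in even length the two middle letters would cancel.\<close>

lemma reduced_winv_neq:
  assumes "reduced u" "winv u = u" shows "u = []"
proof (rule ccontr)
  assume ne: "u \<noteq> []"
  let ?l = "length u"
  have nth: "u ! p = linv (u ! (?l - 1 - p))" if "p < ?l" for p
  proof -
    have "u ! p = winv u ! p" using assms by simp
    then show ?thesis using that by (simp add: winv_def rev_nth)
  qed
  show False
  proof (cases "even ?l")
    case False
    then obtain m where "?l = 2 * m + 1" by (auto elim: oddE)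
    then show False using nth[of m] by simp
  next
    case True
    then obtain m where m: "?l = 2 * m" by (auto elim: evenE)
    with ne have "0 < m" by (auto intro!: Nat.gr0I)
    then obtain k where k: "m = Suc k" by (cases m) auto
    have "u ! Suc k = linv (u ! k)" using nth[of "Suc k"] m k by simp
    moreover have "u = take k u @ u ! k # u ! Suc k # drop (Suc (Suc k)) u"
      using m k by (simp add: id_take_nth_drop Cons_nth_drop_Suc)
    ultimately show False using assms(1) unfolding reduced_iff by metis
  qed
qed

text \<open>If \<open>w = a b\<close> and \<open>winv w = b a\<close>, then inverting the first
  equation and comparing lengths shows that \<open>a\<close> and \<open>b\<close> are both
  self-inverse, hence empty.\<close>

lemma rotate_winv_neq:
  assumes "reduced w" "w \<noteq> []" shows "rotate m (winv w) \<noteq> w"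
proof
  assume eq: "rotate m (winv w) = w"
  let ?k = "m mod length w"
  let ?a = "drop ?k (winv w)" and ?b = "take ?k (winv w)"
  have w: "w = ?a @ ?b" using eq by (simp add: rotate_drop_take)
  have "winv w = ?b @ ?a" by simp
  then have "winv (?a @ ?b) = ?b @ ?a" using w by simp
  then have "winv ?b @ winv ?a = ?b @ ?a" by (simp add: winv_append)
  then have "winv ?b = ?b \<and> winv ?a = ?a" by (subst (asm) append_eq_append_conv) auto
  then have "winv ?b = ?b" "winv ?a = ?a" by blast+
  moreover have "reduced ?a" "reduced ?b"
    using assms(1) w by (metis reduced_append)+
  ultimately have "?a = []" "?b = []" using reduced_winv_neq by blast+
  then show False using w assms(2) by simp
qed

text \<open>Inversion reverses the direction of rotation; \<open>(length w - 1) * k\<close>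
  represents \<open>-k\<close> modulo the length.\<close>

lemma winv_rotate: "winv (rotate k w) = rotate ((length w - 1) * k) (winv w)"
proof (cases "w = []")
  case False
  let ?L = "length w"
  have rr: "rotate k (rotate ((?L - 1) * k) v) = v" if "length v = ?L" for v :: "'a word"
  proof -
    have "k + (?L - 1) * k = ?L * k" using False by (cases ?L) auto
    then show ?thesis using that by (simp add: rotate_rotate rotate_id)
  qed
  have 1: "winv (rotate1 v) = rotate (?L - 1) (winv v)" if l: "length v = ?L" for v :: "'a word"
  proof (cases v)
    case (Cons a v')
    have "winv (rotate1 v) = linv a # winv v'" using Cons by (simp add: winv_def)
    moreover have "rotate (length (winv v')) (winv v' @ [linv a]) = linv a # winv v'"
      by (simp only: rotate_append) simp
    moreover have "winv v = winv v' @ [linv a]" using Cons by (simp add: winv_def)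
    moreover have "?L - 1 = length (winv v')" using Cons l[symmetric] by simp
    ultimately show ?thesis using Cons by metis
  qed (use l False in auto)
  show ?thesis
  proof (induction k)
    case (Suc k)
    show ?case using Suc 1[of "rotate k w"] by (simp add: rotate_rotate ac_simps)
  qed simp
qed simp

text \<open>The inverse of \<open>a b z\<close> ends in the inverses of \<open>b\<close> and
  \<open>a\<close>; rotating by the length minus 2 brings these two letters to the front. Hence the
  pairing stays within the rotations of a relator and its inverse.\<close>

lemma flip_word_eq: "2 \<le> length v \<Longrightarrow> flip_word v = rotate (length v - 2) (winv v)"
proof (induction v rule: flip_word.induct)
  case (1 a b z)
  have "rotate (length (winv z)) (winv z @ [linv b, linv a]) = [linv b, linv a] @ winv z"
    by (rule rotate_append)
  moreover have "winv (a # b # z) = winv z @ [linv b, linv a]" by (simp add: winv_def)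
  ultimately show ?case by (simp del: rotate_Suc)
qed auto

lemma flip_word_flip_word: "flip_word (flip_word v) = v"
  by (induction v rule: flip_word.induct) auto

section \<open>The symmetrised relators of \<open>P\<^sub>n(w)\<close>\<close>

text \<open>Doubling on the residues modulo an even \<open>n\<close> has kernel consisting of 0 and
  \<open>n div 2\<close>.\<close>

lemma dvd_two_mult_half:
  fixes n j :: nat
  assumes "even n" "0 < n" "n dvd 2 * j"
  shows "n dvd j \<or> j mod n = n div 2"
proof -
  obtain h where h: "n = 2 * h" using assms(1) by (auto elim: evenE)
  then obtain c where c: "j = h * c" using assms(3) by (auto simp: dvd_def)
  show ?thesis
  proof (cases "even c")
    case True
    then show ?thesis using h c by (auto elim!: evenE)
  next
    case False
    then obtain e where "c = 2 * e + 1" by (auto elim: oddE)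
    then have "j = n * e + h" using h c by (simp add: algebra_simps)
    then show ?thesis using h assms(2) by simp
  qed
qed

lemma rotate_cong:
  "i mod length w = j mod length w \<Longrightarrow> rotate i w = rotate j w"
  by (metis rotate_conv_mod)

text \<open>\<open>h\<close> stands for \<open>n div 2\<close>; the form \<open>n = 2 * h\<close>
  keeps later arithmetic free of division.\<close>

locale star_word =
  fixes n h :: nat and u w :: "nat word"
  assumes n_eq: "n = 2 * h" and h_pos: "0 < h" and u_free: "u \<in> free_grp {..<n}" and u_ne: "u \<noteq> []"
    and w_def: "w = fmul u (winv ((theta n ^^ h) u))"
    and w_np: "\<not> proper_power {..<n} w"
begin

abbreviation "l \<equiv> length u"
abbreviation "L \<equiv> 2 * length u"

lemma n2: "n \<ge> 2" and evn: "even n" and half: "n div 2 = h"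
  using n_eq h_pos by auto

lemma hh: "h + h = n"
  using n_eq by simp

lemma h_less: "h < n" and n_le: "n \<le> h + h" "h + h \<le> n"
  using n_eq h_pos by auto

lemma l_pos: "0 < l" and l_ge: "Suc 0 \<le> l" and L_ge: "2 \<le> L"
  using u_ne by (simp_all add: Suc_le_eq)

lemma u_reduced: "reduced u" and u_bounded: "a \<in> set u \<Longrightarrow> set_letter a \<subseteq> {..<n}"
  using u_free by (auto simp: free_grp_def)

lemma shift_half_neq: "set_letter a \<subseteq> {..<n} \<Longrightarrow> shift n h a \<noteq> a"
  using shift_fixed[of a n h] nat_dvd_not_less[of h n] n_eq h_pos by auto

text \<open>A cancellation at the junction would require the last letter of \<open>u\<close> to be
  fixed by the shift by \<open>h\<close>, which is impossible since \<open>0 < h < n\<close>. So the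
  product in the free group is plain concatenation.\<close>

lemma w_eq: "w = u @ winv (map (shift n h) u)"
proof -
  have "hd (winv (map (shift n h) u)) \<noteq> linv (last u)"
    using u_ne shift_half_neq[of "last u"] u_bounded by (simp add: hd_winv last_map)
  then have "reduced (u @ winv (map (shift n h) u))"
    using u_ne u_reduced u_bounded by (simp add: reduced_append reduced_winv reduced_map_shift)
  then show ?thesis
    using u_bounded by (simp add: w_def fmul_def freduce_reduced theta_funpow)
qed

lemma w_reduced: "reduced w"
proof -
  have "hd (winv (map (shift n h) u)) \<noteq> linv (last u)"
    using u_ne shift_half_neq[of "last u"] u_bounded by (simp add: hd_winv last_map)
  then show ?thesis
    using u_ne u_reduced u_bounded unfolding w_eq
    by (simp add: reduced_append reduced_winv reduced_map_shift)
qed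

lemma length_w [simp]: "length w = L"
  by (simp add: w_eq)

lemma w_ne: "w \<noteq> []"
  by (simp add: w_eq u_ne)

lemma w_bounded: "a \<in> set w \<Longrightarrow> set_letter a \<subseteq> {..<n}"
proof -
  assume "a \<in> set w"
  moreover have "set_letter (linv (shift n h b)) \<subseteq> {..<n}" for b
    using n2 by (cases b) auto
  ultimately show ?thesis using u_bounded by (auto simp: w_eq winv_def)
qed

lemma w_free: "w \<in> free_grp {..<n}"
  using w_reduced w_bounded by (auto simp: free_grp_def)

lemma map_shift_0: "map (shift n 0) w = w"
  using w_bounded by (intro map_idI) (simp add: shift_0)

lemma map_shift_mult: "map (shift n (n * c)) w = w"
  using shift_cong[of "n * c" n 0] map_shift_0 by simp

text \<open>The inverse of \<open>w\<close> is \<open>theta^h(u)\<close> followed by the inverse of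
  \<open>u\<close>, and \<open>theta^(2h)\<close> is the identity on \<open>u\<close>.\<close>

lemma winv_w: "winv w = map (shift n h) w"
proof -
  have "map (shift n (h + h)) u = u"
    using shift_cong[of n n 0] u_bounded unfolding hh
    by (intro map_idI) (simp add: shift_0)
  then have "map (shift n (h + h)) (winv u) = winv u" by (metis winv_map_shift)
  then show ?thesis
    by (simp add: w_eq winv_append winv_map_shift shift_shift comp_def)
qed

section \<open>Rotations and shifts of \<open>w\<close> and their distinctness\<close>

definition cyc :: "nat \<Rightarrow> nat \<Rightarrow> nat word" where
  "cyc k i = rotate k (map (shift n i) w)"

lemma length_cyc [simp]: "length (cyc k i) = L"
  by (simp add: cyc_def)

lemma cyc_cong: "i mod n = i' mod n \<Longrightarrow> k mod L = k' mod L \<Longrightarrow> cyc k i = cyc k' i'"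
  unfolding cyc_def using shift_cong[of i n i'] rotate_cong[of k "map (shift n i) w" k'] by simp

lemma rotate_cyc: "rotate k (cyc k' i) = cyc (k + k') i"
  by (simp add: cyc_def rotate_rotate)

lemma map_shift_cyc: "map (shift n i) (cyc k i') = cyc k (i + i')"
  by (simp add: cyc_def rotate_map[symmetric] shift_shift comp_def)

lemma winv_cyc: "winv (cyc k i) = cyc ((L - 1) * k) (i + h)"
  by (simp add: cyc_def winv_rotate winv_map_shift winv_w shift_shift comp_def)

lemma cyc_0: "cyc 0 0 = w"
  by (simp add: cyc_def map_shift_0)

text \<open>The point is that rotations and shifts together act on \<open>w\<close> with trivial
  stabiliser. Inversion yields a second relation with the opposite rotation, and combining both
  isolates the shift.\<close>

lemma cyc_eq_w:
  assumes "cyc k i = w" shows "L dvd k" "n dvd i"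
proof -
  \<comment> \<open>Inverting the assumed equation and applying \<open>theta^h\<close> negates the
    rotation amount but keeps the shift \<open>i\<close>.\<close>
  have "w = map (shift n h) (winv w)"
    using map_shift_mult[of 1] by (simp add: winv_w shift_shift comp_def hh)
  also have "\<dots> = map (shift n h) (cyc ((L - 1) * k) (i + h))" using winv_cyc[of k i] assms by simp
  also have "\<dots> = cyc ((L - 1) * k) i"
    unfolding map_shift_cyc
  proof (intro cyc_cong)
    have "h + (i + h) = i + n" using hh by linarith
    then show "(h + (i + h)) mod n = i mod n" by (simp only: mod_add_self2)
  qed simp
  finally have w': "w = cyc ((L - 1) * k) i" .
  \<comment> \<open>Substituting \<open>w'\<close> makes the rotations by \<open>k\<close> and
    \<open>-k\<close> cancel, so \<open>theta^(2i)\<close> fixes \<open>w\<close>; its first letter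
    then gives \<open>n dvd 2 * i\<close>.\<close>
  have "w = rotate k (map (shift n i) w)" using assms by (simp add: cyc_def)
  also have "\<dots> = cyc (k + (L - 1) * k) (i + i)"
    by (subst w') (simp add: map_shift_cyc rotate_cyc)
  also have "k + (L - 1) * k = L * k" using l_pos by (cases l) auto
  also have "cyc (L * k) (i + i) = map (shift n (i + i)) w"
    by (simp add: cyc_def rotate_id)
  finally have "map (shift n (2 * i)) w = w" by (simp add: mult_2)
  then have "shift n (2 * i) (hd w) = hd w" using w_ne by (metis hd_map)
  then have "n dvd 2 * i" using shift_fixed w_bounded w_ne by (metis hd_in_set)
  then have "n dvd i \<or> i mod n = h" using dvd_two_mult_half[of n i] evn n2 half by auto
  \<comment> \<open>A shift by \<open>h\<close> is inversion of \<open>w\<close>, so this case would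
    exhibit \<open>w\<close> as a rotation of its own inverse.\<close>
  moreover have "i mod n \<noteq> h"
  proof
    assume "i mod n = h"
    then have "cyc k i = rotate k (winv w)"
      unfolding winv_w cyc_def[symmetric] using n2 by (intro cyc_cong) auto
    then show False using rotate_winv_neq w_reduced w_ne assms by metis
  qed
  ultimately show "n dvd i" by blast
  \<comment> \<open>Only a pure rotation is left; a nonzero remainder \<open>k mod L\<close> would
    make \<open>w\<close> a proper power.\<close>
  then have "cyc k i = rotate (k mod L) w"
    using cyc_cong[of i 0 k "k mod L"] map_shift_0 by (auto simp: cyc_def)
  then show "L dvd k"
    using proper_powerI_rotate[OF w_free, of "k mod L"] w_np assms l_pos
    by (auto simp: dvd_eq_mod_eq_0)
qed

text \<open>Undoing the rotation by \<open>k'\<close> and the shift by \<open>i'\<close> on both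
  sides reduces the claim to the trivial stabiliser of \<open>w\<close>.\<close>

lemma cyc_inj:
  assumes "cyc k i = cyc k' i'" "k < L" "k' < L" "i < n" "i' < n"
  shows "k = k'" "i = i'"
proof -
  \<comment> \<open>Here \<open>a + (m - 1) * b\<close> represents \<open>a - b\<close> modulo
    \<open>m\<close>.\<close>
  have cong: "a = b" if "m dvd a + (m - 1) * b" "a < m" "b < m" for a b m :: nat
  proof -
    have "b + (m - 1) * b = m * b" using that by (cases m) auto
    then have "[a + (m - 1) * b = b + (m - 1) * b] (mod m)"
      using that(1) by (metis cong_0_iff cong_sym cong_trans dvd_triv_left)
    then have "[a = b] (mod m)" by (simp only: cong_add_rcancel_nat)
    then show ?thesis using that(2,3) by (rule cong_less_modulus_unique_nat)
  qed
  have "rotate ((L - 1) * k') (map (shift n ((n - 1) * i')) (cyc k' i')) = cyc 0 0"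
  proof -
    have "(m - 1) * b + b = m * b" if "0 < m" for m b :: nat
      using that by (cases m) auto
    then have "(L - 1) * k' + k' = L * k'" "(n - 1) * i' + i' = n * i'"
      using n2 l_pos by auto
    then show ?thesis by (simp only: map_shift_cyc rotate_cyc) (intro cyc_cong; simp)
  qed
  then have "cyc ((L - 1) * k' + k) ((n - 1) * i' + i) = w"
    by (simp add: assms(1)[symmetric] map_shift_cyc rotate_cyc cyc_0)
  from cyc_eq_w[OF this] have "L dvd k + (L - 1) * k'" "n dvd i + (n - 1) * i'"
    by (simp_all add: add.commute)
  then show "k = k'" "i = i'" using cong assms by blast+
qed

lemma relators: "snd (cyclic_pres n w) = {cyc 0 i | i. i < n}"
  using w_bounded by (auto simp: cyclic_pres_def theta_funpow cyc_def)

lemma winv_cyc_0: "i < n \<Longrightarrow> \<exists>j<n. winv (cyc 0 i) = cyc 0 j"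
  unfolding winv_cyc using n2 by (intro exI[of _ "(i + h) mod n"] conjI cyc_cong) auto

text \<open>Inverses add nothing, because the inverse of \<open>w\<close> is its shift by
  \<open>h\<close>; only rotations remain to be adjoined, and they matter modulo
  \<open>L\<close>.\<close>

lemma sym_relators_eq:
  "sym_relators (snd (cyclic_pres n w)) = {cyc k i | k i. k < L \<and> i < n}"
proof -
  let ?R = "{cyc 0 i | i. i < n}"
  have "winv ` ?R \<subseteq> ?R" using winv_cyc_0 by auto
  then have "sym_relators ?R = {rotate k r | k r. r \<in> ?R}"
    unfolding sym_relators_def by blast
  also have "\<dots> = {cyc k i | k i. i < n}"
  proof (intro equalityI subsetI; clarify)
    fix k i assume "i < n"
    then show "\<exists>k' i'. rotate k (cyc 0 i) = cyc k' i' \<and> i' < n"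
      by (auto simp: rotate_cyc)
  next
    fix k i assume "i < n"
    then show "\<exists>k' r. cyc k i = rotate k' r \<and> r \<in> ?R"
      by (intro exI[of _ k] exI[of _ "cyc 0 i"]) (auto simp: rotate_cyc)
  qed
  also have "\<dots> = {cyc k i | k i. k < L \<and> i < n}"
  proof (intro equalityI subsetI; clarify)
    fix k i assume "i < n"
    moreover have "cyc k i = cyc (k mod L) i" by (intro cyc_cong) auto
    moreover have "k mod L < L" using l_pos by (intro mod_less_divisor) simp
    ultimately show "\<exists>k' i'. cyc k i = cyc k' i' \<and> k' < L \<and> i' < n" by blast
  qed blast
  finally show ?thesis by (simp add: relators)
qed

section \<open>The pairing on indices of symmetrised relators\<close>

lemma flip_cyc: "flip_word (cyc k i) = cyc (L - 2 + (L - 1) * k) (i + h)"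
  using L_ge by (simp add: flip_word_eq winv_cyc rotate_cyc)

text \<open>One representative of each orbit of \<open>(k, i) \<mapsto> (-2-k, i+h)\<close> on \<open>{..<L} \<times> {..<n}\<close>.\<close>

definition edge_index :: "(nat \<times> nat) set" where
  "edge_index = {..<l - 1} \<times> {..<n} \<union> {l - 1, L - 1} \<times> {..<h}"

definition flip_class :: "nat \<times> nat \<Rightarrow> nat word set" where
  "flip_class p = {cyc (fst p) (snd p), flip_word (cyc (fst p) (snd p))}"

text \<open>The representative of \<open>-2 - k\<close> below \<open>L\<close>. The value
  \<open>k = L - 1\<close> is separate because \<open>L - 2 - k\<close> would be truncated to 0
  there; it is a fixed point, as is \<open>l - 1\<close>.\<close>

definition flip_k :: "nat \<Rightarrow> nat" where
  "flip_k k = (if k = L - 1 then L - 1 else L - 2 - k)"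

lemma flip_cyc': "k < L \<Longrightarrow> flip_word (cyc k i) = cyc (flip_k k) ((i + h) mod n)"
  unfolding flip_cyc
proof (intro cyc_cong)
  assume k: "k < L"
  show "(L - 2 + (L - 1) * k) mod L = flip_k k mod L"
  proof (cases "k = L - 1")
    case True
    obtain m where m: "l = Suc m" using l_pos by (cases l) auto
    have "L - 2 + (L - 1) * k = L * (2 * m) + (L - 1)" using True m by (simp add: algebra_simps)
    then show ?thesis using True by (simp only: flip_k_def if_True refl mod_mult_self4)
  next
    case False
    then have "L - 2 + (L - 1) * k = L * k + (L - 2 - k)"
      using k by (simp add: algebra_simps diff_mult_distrib)
    then show ?thesis by (simp only: False flip_k_def if_False mod_mult_self4)
  qed
qed simp

lemma flip_k_less: "k < L \<Longrightarrow> flip_k k < L"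
  by (auto simp: flip_k_def)

lemma edge_index_iff: "(k, i) \<in> edge_index \<longleftrightarrow> k < l - 1 \<and> i < n \<or> (k = l - 1 \<or> k = L - 1) \<and> i < h"
  by (auto simp: edge_index_def)

lemma edge_index_less: "(k, i) \<in> edge_index \<Longrightarrow> k < L \<and> i < n"
  using h_less l_ge by (auto simp: edge_index_iff)

lemma add_half_mod: "i < n \<Longrightarrow> (i + h) mod n = (if i < h then i + h else i - h)"
  using n_le h_pos by (auto simp: mod_if)

text \<open>Equal classes have equal or flipped indices. The flip leaves \<open>edge_index\<close>:
  it sends \<open>k < l - 1\<close> to a position from \<open>l\<close> to \<open>L - 2\<close>, and
  at the two fixed positions it moves \<open>i < h\<close> to \<open>i + h\<close>.\<close>

lemma flip_class_inj: "inj_on flip_class edge_index"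
proof (rule inj_onI, clarify)
  fix k i k' i' assume edge_index: "(k, i) \<in> edge_index" "(k', i') \<in> edge_index" and eq: "flip_class (k, i) = flip_class (k', i')"
  from edge_index have lt: "k < L" "i < n" "k' < L" "i' < n" using edge_index_less by auto
  from eq have "cyc k i = cyc k' i' \<or> cyc k i = flip_word (cyc k' i')"
    by (auto simp: flip_class_def)
  then show "k = k' \<and> i = i'"
  proof
    assume "cyc k i = cyc k' i'"
    then show ?thesis using cyc_inj lt by blast
  next
    assume "cyc k i = flip_word (cyc k' i')"
    then have ki: "k = flip_k k'" "i = (i' + h) mod n"
      using cyc_inj lt flip_k_less by (auto simp: flip_cyc')
    consider "k' < l - 1" | "k' = l - 1 \<or> k' = L - 1" "i' < h"
      using edge_index(2) unfolding edge_index_iff by blast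
    then have "(k, i) \<notin> edge_index"
    proof cases
      case 1
      then have "k' \<noteq> L - 1" by linarith
      then have "k = L - 2 - k'" using ki(1) by (simp only: flip_k_def if_False)
      then have "k \<ge> l" "k < L - 1" using 1 by linarith+
      then show ?thesis unfolding edge_index_iff by linarith
    next
      case 2
      then have "i = i' + h" using ki(2) add_half_mod[OF lt(4)] by simp
      moreover have "\<not> k < l - 1"
        using 2(1) l_ge unfolding ki(1) flip_k_def by (split if_split) linarith
      ultimately show ?thesis unfolding edge_index_iff by linarith
    qed
    then show ?thesis using edge_index by blast
  qed
qed

lemma flip_class_image:
  "flip_class ` edge_index = {{v, flip_word v} | v. v \<in> sym_relators (snd (cyclic_pres n w)) \<and> 2 \<le> length v}"
proof -
  have "\<exists>p\<in>edge_index. {cyc k i, flip_word (cyc k i)} = flip_class p" if lt: "k < L" "i < n" for k i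
  proof (cases "(k, i) \<in> edge_index")
    case True
    then show ?thesis by (intro bexI[of _ "(k, i)"]) (auto simp: flip_class_def)
  next
    case False
    let ?p = "(flip_k k, (i + h) mod n)"
    \<comment> \<open>Outside \<open>edge_index\<close> lie the upper halves at the two self-paired
      positions and all positions from \<open>l\<close> to \<open>L - 2\<close>; the flip carries
      each of these into \<open>edge_index\<close>.\<close>
    consider "k = l - 1" "h \<le> i" | "k = L - 1" "h \<le> i" | "l \<le> k" "k < L - 1"
      using False lt unfolding edge_index_iff by linarith
    moreover have "(i + h) mod n < h" if "h \<le> i"
      using that add_half_mod[OF lt(2)] n_le(1) lt(2) by simp
    moreover have "flip_k (l - 1) = l - 1" "flip_k (L - 1) = L - 1"
      using l_ge by (auto simp: flip_k_def)
    moreover have "flip_k k < l - 1" if "l \<le> k" "k < L - 1"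
      using that unfolding flip_k_def by (split if_split) linarith
    moreover have "(i + h) mod n < n" using n2 by simp
    ultimately have "?p \<in> edge_index" unfolding edge_index_iff by metis
    moreover have "{cyc k i, flip_word (cyc k i)} = flip_class ?p"
      unfolding flip_class_def fst_conv snd_conv flip_cyc'[OF lt(1), symmetric] flip_word_flip_word
      by (rule insert_commute)
    ultimately show ?thesis by blast
  qed
  moreover have "flip_class p \<in> {{v, flip_word v} | v. v \<in> {cyc k i | k i. k < L \<and> i < n}}" if "p \<in> edge_index" for p
    using that edge_index_less[of "fst p" "snd p"] unfolding flip_class_def by auto
  ultimately have "flip_class ` edge_index = {{v, flip_word v} | v. v \<in> {cyc k i | k i. k < L \<and> i < n}}"
    by (intro equalityI subsetI) (clarify; blast)+
  also have "\<dots> = {{v, flip_word v} | v. v \<in> {cyc k i | k i. k < L \<and> i < n} \<and> 2 \<le> length v}"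
    using L_ge by (intro Collect_cong ex_cong1) auto
  finally show ?thesis unfolding sym_relators_eq .
qed

section \<open>Endpoints of edges read off cyclically from \<open>w\<close>\<close>

definition wletter :: "nat \<Rightarrow> nat letter" where
  "wletter k = w ! (k mod L)"

definition edge :: "nat \<times> nat \<Rightarrow> nat letter set" where
  "edge p = {shift n (snd p) (wletter (fst p)), linv (shift n (snd p) (wletter (Suc (fst p))))}"

lemma cyc_nth: "m < L \<Longrightarrow> cyc k i ! m = shift n i (wletter (k + m))"
  using l_pos by (simp add: cyc_def nth_rotate wletter_def)

text \<open>Both words of a class name the same ends: \<open>a b z\<close> gives \<open>a\<close>
  and the inverse of \<open>b\<close>, and the flipped word gives these in the other order.\<close>

lemma flip_class_edge: "(\<Union>v\<in>flip_class p. {v ! 0, linv (v ! 1)}) = edge p"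
proof -
  let ?v = "cyc (fst p) (snd p)"
  note L2 = L_ge
  then have len: "2 \<le> length ?v" by simp
  have "\<exists>a b z. v = a # b # z" if "2 \<le> length v" for v :: "nat word"
    using that by (cases v rule: flip_word.cases) auto
  with len obtain a b z where v: "?v = a # b # z" by blast
  have "a = ?v ! 0" "b = ?v ! 1" using v by auto
  then have "a = shift n (snd p) (wletter (fst p))" "b = shift n (snd p) (wletter (Suc (fst p)))"
    using cyc_nth[of 0 "fst p" "snd p"] cyc_nth[of 1 "fst p" "snd p"] L2 by (simp_all add: u_ne)
  then show ?thesis unfolding flip_class_def v edge_def by (simp add: insert_commute)
qed

text \<open>Injectivity of \<open>flip_class\<close> is what preserves multiplicities: distinct
  indices are distinct classes, even when their edges are parallel.\<close>

lemma edges_star_graph: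
  "edges (star_graph (cyclic_pres n w)) = image_mset edge (mset_set edge_index)"
proof -
  have "edges (star_graph (cyclic_pres n w)) =
      image_mset (\<lambda>c. \<Union>v\<in>c. {v ! 0, linv (v ! 1)}) (mset_set (flip_class ` edge_index))"
    unfolding flip_class_image by (simp add: star_graph_def split: prod.split)
  also have "\<dots> = image_mset edge (mset_set edge_index)"
    unfolding image_mset_mset_set[OF flip_class_inj, symmetric] multiset.map_comp comp_def flip_class_edge ..
  finally show ?thesis .
qed

end

section \<open>Edges of the star graph\<close>

lemma image_mset_mset_set_bij:
  "bij_betw g A B \<Longrightarrow> image_mset (\<lambda>x. f (g x)) (mset_set A) = image_mset f (mset_set B)"
  by (metis bij_betw_def image_mset_mset_set multiset.map_comp comp_def image_mset_cong)

lemma image_mset_mset_set_Times: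
  assumes "finite A" "finite B"
  shows "image_mset f (mset_set (A \<times> B)) =
    (\<Sum>a\<in>#mset_set A. image_mset (\<lambda>b. f (a, b)) (mset_set B))"
  using assms(1)
proof (induction A)
  case (insert a A)
  have "mset_set (insert a A \<times> B) = mset_set ({a} \<times> B) + mset_set (A \<times> B)"
    using insert assms(2)
    by (subst mset_set_Union[symmetric]) (auto intro!: arg_cong[of _ _ mset_set])
  moreover have "image_mset f (mset_set ({a} \<times> B)) = image_mset (\<lambda>b. f (a, b)) (mset_set B)"
    by (rule image_mset_mset_set_bij[symmetric]) (auto simp: bij_betw_def inj_on_def)
  ultimately show ?case using insert by simp
qed simp

lemma bij_betw_add_mod:
  assumes "0 < n" shows "bij_betw (\<lambda>i. (x + i) mod n) {..<n} {..<n :: nat}"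
proof -
  have "inj_on (\<lambda>i. (x + i) mod n) {..<n}"
  proof (rule inj_onI)
    fix i j assume "i \<in> {..<n}" "j \<in> {..<n}" "(x + i) mod n = (x + j) mod n"
    moreover from this have "[x + i = x + j] (mod n)" by (simp add: cong_def)
    then have "[i = j] (mod n)" by (simp only: cong_add_lcancel_nat)
    ultimately show "i = j" by (simp add: cong_less_modulus_unique_nat)
  qed
  moreover have "(\<lambda>i. (x + i) mod n) ` {..<n} \<subseteq> {..<n}" using assms by auto
  ultimately show ?thesis
    by (metis bij_betw_def endo_inj_surj finite_lessThan)
qed

lemma image_mset_add_mod:
  "0 < n \<Longrightarrow> image_mset (\<lambda>i. f ((x + i) mod n)) (mset_set {..<n}) = image_mset f (mset_set {..<n :: nat})"
  by (rule image_mset_mset_set_bij[OF bij_betw_add_mod])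

lemma sdiff_less: "0 < n \<Longrightarrow> sdiff n j i < n"
  by (simp add: sdiff_def nat_less_iff)

lemma add_sdiff_mod:
  assumes "0 < n" shows "((x + i) mod n + sdiff n y x) mod n = (y + i) mod n"
proof -
  have "int (((x + i) mod n + sdiff n y x) mod n) = ((int x + int i) mod int n + (int y - int x) mod int n) mod int n"
    using assms by (simp add: sdiff_def zmod_int)
  also have "\<dots> = (int y + int i) mod int n" by (simp add: mod_simps add.commute)
  also have "\<dots> = int ((y + i) mod n)" by (simp add: zmod_int)
  finally show ?thesis by simp
qed

lemma shift_edges_simps [simp]:
  "shift_edges n m {#} e = {#}"
  "shift_edges n m (add_mset s S) e =
    image_mset (\<lambda>i. e i ((i + s) mod n)) (mset_set {..<m}) + shift_edges n m S e"
  "shift_edges n m (S + S') e = shift_edges n m S e + shift_edges n m S' e"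
  by (simp_all add: shift_edges_def)

text \<open>As \<open>i\<close> runs through a full period, the starting subscript can be absorbed
  by reindexing; only the difference of the two subscripts survives.\<close>

lemma shift_edges_sdiff:
  assumes "0 < n"
  shows "image_mset (\<lambda>i. e ((x + i) mod n) ((y + i) mod n)) (mset_set {..<n}) =
    image_mset (\<lambda>i. e i ((i + sdiff n y x) mod n)) (mset_set {..<n})"
  using image_mset_add_mod[OF assms, of "\<lambda>i. e i ((i + sdiff n y x) mod n)" x]
  by (simp add: add_sdiff_mod assms)

abbreviation (input) Pos_edge :: "nat \<Rightarrow> nat \<Rightarrow> nat letter set" where
  "Pos_edge \<equiv> \<lambda>i k. {Pos i, Pos k}"

abbreviation (input) Neg_edge :: "nat \<Rightarrow> nat \<Rightarrow> nat letter set" where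
  "Neg_edge \<equiv> \<lambda>i k. {Neg i, Neg k}"

abbreviation (input) mixed_edge :: "nat \<Rightarrow> nat \<Rightarrow> nat letter set" where
  "mixed_edge \<equiv> \<lambda>i k. {Pos i, Neg k}"

text \<open>Each adjacent pair contributes one orbit of \<open>n\<close> edges. Since the second
  letter is inverted, opposite signs give an edge between vertices of one sign, and equal signs give
  a mixed edge.\<close>

lemma subword_edges:
  assumes "0 < n"
  shows "(\<Sum>p\<leftarrow>ps. image_mset (\<lambda>i. {shift n i (fst p), linv (shift n i (snd p))}) (mset_set {..<n})) =
     shift_edges n n (mset [sdiff n j i. (Pos i, Neg j) \<leftarrow> ps]) Pos_edge
   + shift_edges n n (mset [sdiff n j i. (Neg i, Pos j) \<leftarrow> ps]) Neg_edge
   + shift_edges n n (mset [sdiff n j i. (Pos i, Pos j) \<leftarrow> ps]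
       + mset [sdiff n j i. (Neg j, Neg i) \<leftarrow> ps]) mixed_edge"
proof (induction ps)
  case (Cons p ps)
  have 1: "image_mset (\<lambda>i. {Pos ((x + i) mod n), Pos ((y + i) mod n)}) (mset_set {..<n}) =
      image_mset (\<lambda>i. {Pos i, Pos ((i + sdiff n y x) mod n)}) (mset_set {..<n})" for x y
    using shift_edges_sdiff[OF assms, of Pos_edge] .
  have 2: "image_mset (\<lambda>i. {Neg ((x + i) mod n), Neg ((y + i) mod n)}) (mset_set {..<n}) =
      image_mset (\<lambda>i. {Neg i, Neg ((i + sdiff n y x) mod n)}) (mset_set {..<n})" for x y
    using shift_edges_sdiff[OF assms, of Neg_edge] .
  have 3: "image_mset (\<lambda>i. {Pos ((x + i) mod n), Neg ((y + i) mod n)}) (mset_set {..<n}) =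
      image_mset (\<lambda>i. {Pos i, Neg ((i + sdiff n y x) mod n)}) (mset_set {..<n})" for x y
    using shift_edges_sdiff[OF assms, of mixed_edge] .
  \<comment> \<open>A pair of two negative letters lists the negative end first; its shift is still
    counted from the positive end.\<close>
  have 4: "image_mset (\<lambda>i. {Neg ((y + i) mod n), Pos ((x + i) mod n)}) (mset_set {..<n}) =
      image_mset (\<lambda>i. {Pos i, Neg ((i + sdiff n y x) mod n)}) (mset_set {..<n})" for x y
    using 3 by (simp add: insert_commute)
  show ?case
  proof (cases p)
    case (Pair a b)
    then show ?thesis using Cons
      by (cases a; cases b) (simp_all add: 1 2 3 4)
  qed
qed simp

lemma sum_mset_image_mset: "(\<Sum>x\<in>#mset xs. f x) = (\<Sum>x\<leftarrow>xs. f x)"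
  by (metis mset_map sum_mset_sum_list)

lemma zip_tl_conv: "zip u (tl u) = map (\<lambda>k. (u ! k, u ! Suc k)) [0..<length u - 1]"
  by (rule nth_equalityI) (auto simp: nth_tl)

text \<open>An antipodal pair is determined by its subscript modulo \<open>h\<close>, so any
  \<open>h\<close> consecutive starting points meet every pair once. Symmetry of \<open>e\<close>
  absorbs the exchange of ends on wrapping around.\<close>

lemma half_edges:
  assumes "n = 2 * h" "0 < h" and comm: "\<And>i k. e i k = e k i"
  shows "image_mset (\<lambda>i. e ((x + i) mod n) ((x + (i + h)) mod n)) (mset_set {..<h}) =
    shift_edges n h {#h#} e"
proof -
  have "e ((x + i) mod n) ((x + (i + h)) mod n) = e ((x + i) mod h) (((x + i) mod h + h) mod n)" for i
  proof -
    let ?r = "(x + i) mod h"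
    have r: "?r < h" using assms by simp
    \<comment> \<open>The parity of the quotient by \<open>h\<close> tells in which half of the
      cycle the subscript lies; adding \<open>h\<close> changes only this parity.\<close>
    have *: "m mod n = h * (m div h mod 2) + m mod h" for m
      using mod_mult2_eq[of m h 2] assms by (simp add: mult.commute)
    have "(x + (i + h)) div h = Suc ((x + i) div h)" using assms
      by (metis add.assoc div_add_self2 less_irrefl Suc_eq_plus1)
    then have "(x + (i + h)) mod n = h * (Suc ((x + i) div h) mod 2) + ?r"
      using *[of "x + (i + h)"] by (simp flip: add.assoc)
    moreover have "(x + i) mod n = h * ((x + i) div h mod 2) + ?r" by (rule *)
    moreover have "(?r + h) mod n = ?r + h" using r assms by simp
    ultimately show ?thesis
      by (cases "even ((x + i) div h)") (auto simp: mod2_eq_if comm ac_simps)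
  qed
  then show ?thesis
    using image_mset_add_mod[OF assms(2), of "\<lambda>i. e i ((i + h) mod n)" x] by simp
qed

section \<open>The two junctions of \<open>w\<close> and the full list of edges\<close>

context star_word
begin

lemma wletter_eq: "wletter k = (u @ winv (map (shift n h) u)) ! (k mod L)"
  by (simp add: wletter_def flip: w_eq)

lemma wletter_u: "k < l \<Longrightarrow> wletter k = u ! k"
  by (simp add: wletter_eq nth_append)

lemma wletter_l: "wletter l = linv (shift n h (last u))"
  using u_ne by (simp add: wletter_eq nth_append winv_def rev_nth last_conv_nth)

lemma wletter_last: "wletter (L - 1) = linv (shift n h (hd u))"
proof -
  have "wletter (L - 1) = last w" using w_ne l_pos by (simp add: wletter_def last_conv_nth)
  then show ?thesis using u_ne by (simp add: w_eq last_winv hd_map)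
qed

text \<open>At the junction after \<open>u\<close> the next letter is already an inverse, so
  inverting it returns the last letter of \<open>u\<close> shifted by \<open>h\<close>. Both ends
  have the sign of that letter.\<close>

lemma edge_last: "edge (l - 1, i) = {shift n i (last u), shift n (i + h) (last u)}"
  using wletter_u[of "l - 1"] wletter_l u_ne
  by (simp add: edge_def last_conv_nth linv_shift shift_shift)

text \<open>At the cyclic junction from the end of \<open>w\<close> back to its start, both ends
  have the sign opposite to that of the first letter of \<open>u\<close>.\<close>

lemma edge_hd: "edge (L - 1, i) = {linv (shift n i (hd u)), linv (shift n (i + h) (hd u))}"
proof -
  have "wletter (Suc (L - 1)) = hd u"
    using wletter_u[of 0] u_ne by (simp add: wletter_def hd_conv_nth)
  then show ?thesis using wletter_last
    by (auto simp add: edge_def linv_shift shift_shift)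
qed

text \<open>The multiplicities of \<open>n/2\<close> in \<open>Abar - Abar'\<close> and \<open>Bbar - Bbar'\<close>.\<close>

definition half_pos :: nat where
  "half_pos = of_bool (positive (last u)) + of_bool (\<not> positive (hd u))"

definition half_neg :: nat where
  "half_neg = of_bool (\<not> positive (last u)) + of_bool (positive (hd u))"

lemma Abar_eq: "Abar n u = Abar' n u + replicate_mset half_pos h"
  and Bbar_eq: "Bbar n u = Bbar' n u + replicate_mset half_neg h"
  unfolding Abar_def Bbar_def ABbar_def half_pos_def half_neg_def half by auto

lemma half_edges_u:
  "image_mset edge (mset_set ({l - 1, L - 1} \<times> {..<h})) =
     shift_edges n h (replicate_mset half_pos h) Pos_edge +
     shift_edges n h (replicate_mset half_neg h) Neg_edge"
proof -
  have "l - 1 \<noteq> L - 1" using l_ge by linarith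
  then have "image_mset edge (mset_set ({l - 1, L - 1} \<times> {..<h})) =
     image_mset (\<lambda>i. edge (l - 1, i)) (mset_set {..<h}) + image_mset (\<lambda>i. edge (L - 1, i)) (mset_set {..<h})"
    by (subst image_mset_mset_set_Times) simp_all
  moreover have "image_mset (\<lambda>i. edge (l - 1, i)) (mset_set {..<h}) =
      (if positive (last u) then shift_edges n h {#h#} Pos_edge else shift_edges n h {#h#} Neg_edge)"
    unfolding edge_last
    using half_edges[OF n_eq h_pos, of Pos_edge] half_edges[OF n_eq h_pos, of Neg_edge]
    by (cases "last u") (simp_all add: insert_commute)
  moreover have "image_mset (\<lambda>i. edge (L - 1, i)) (mset_set {..<h}) =
      (if positive (hd u) then shift_edges n h {#h#} Neg_edge else shift_edges n h {#h#} Pos_edge)"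
    unfolding edge_hd
    using half_edges[OF n_eq h_pos, of Pos_edge] half_edges[OF n_eq h_pos, of Neg_edge]
    by (cases "hd u") (simp_all add: insert_commute)
  ultimately show ?thesis
    by (simp add: half_pos_def half_neg_def numeral_2_eq_2)
qed

text \<open>The positions \<open>k < l - 1\<close> are the adjacent pairs of \<open>u\<close> and
  give full orbits; the two junctions give the half orbits.\<close>

lemma edges_formula:
  "edges (star_graph (cyclic_pres n w)) =
        shift_edges n n (Abar' n u) Pos_edge
      + shift_edges n n (Bbar' n u) Neg_edge
      + shift_edges n n (Qbar n u) mixed_edge
      + shift_edges n h (replicate_mset half_pos h) Pos_edge
      + shift_edges n h (replicate_mset half_neg h) Neg_edge"
proof -
  have "edge_index = {..<l - 1} \<times> {..<n} \<union> {l - 1, L - 1} \<times> {..<h}"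
    by (rule edge_index_def)
  moreover have "({..<l - 1} \<times> {..<n}) \<inter> ({l - 1, L - 1} \<times> {..<h}) = {}" by auto
  ultimately have "mset_set edge_index = mset_set ({..<l - 1} \<times> {..<n}) + mset_set ({l - 1, L - 1} \<times> {..<h})"
    by (simp add: mset_set_Union)
  then have "image_mset edge (mset_set edge_index) =
      image_mset edge (mset_set ({..<l - 1} \<times> {..<n})) + image_mset edge (mset_set ({l - 1, L - 1} \<times> {..<h}))"
    by simp
  moreover have "image_mset edge (mset_set ({..<l - 1} \<times> {..<n})) =
      shift_edges n n (Abar' n u) Pos_edge + shift_edges n n (Bbar' n u) Neg_edge
      + shift_edges n n (Qbar n u) mixed_edge"
  proof -
    let ?f = "\<lambda>p. image_mset (\<lambda>i. {shift n i (fst p), linv (shift n i (snd p))}) (mset_set {..<n})"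
    have "image_mset edge (mset_set ({..<l - 1} \<times> {..<n})) =
        (\<Sum>k\<in>#mset_set {..<l - 1}. image_mset (\<lambda>i. edge (k, i)) (mset_set {..<n}))"
      by (rule image_mset_mset_set_Times) simp_all
    also have "\<dots> = (\<Sum>k\<in>#mset_set {..<l - 1}. ?f (u ! k, u ! Suc k))"
      by (intro arg_cong[of _ _ sum_mset] image_mset_cong) (auto simp: edge_def wletter_u)
    also have "\<dots> = (\<Sum>k\<leftarrow>[0..<l - 1]. ?f (u ! k, u ! Suc k))"
      by (simp only: lessThan_atLeast0 sum_mset_image_mset flip: mset_upt)
    also have "\<dots> = (\<Sum>p\<leftarrow>zip u (tl u). ?f p)"
      by (simp add: zip_tl_conv comp_def)
    also have "\<dots> = shift_edges n n (Abar' n u) Pos_edge + shift_edges n n (Bbar' n u) Neg_edge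
      + shift_edges n n (Qbar n u) mixed_edge"
      using subword_edges n2 unfolding Abar'_def Bbar'_def Qbar_def by simp
    finally show ?thesis .
  qed
  ultimately show ?thesis by (simp only: edges_star_graph half_edges_u add.assoc)
qed

end

section \<open>Regularity\<close>

lemma size_filter_image_mset_set:
  "finite A \<Longrightarrow> size (filter_mset P (image_mset f (mset_set A))) = card {x \<in> A. P (f x)}"
  by (simp add: filter_mset_image_mset filter_mset_mset_set)

lemma size_nbhd: "size (nbhd G v) = size {#e \<in># edges G. v \<in> e#}"
  by (simp add: nbhd_def)

lemma size_shift_edges_at:
  assumes "\<And>s. s \<in># S \<Longrightarrow> card {i. i < m \<and> v \<in> e i ((i + s) mod n)} = c"
  shows "size {#x \<in># shift_edges n m S e. v \<in> x#} = c * size S"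
  using assms by (induction S) (simp_all add: size_filter_image_mset_set lessThan_def)

lemma card_add_mod_eq:
  fixes n :: nat assumes "j < n" shows "card {i. i < n \<and> (i + s) mod n = j} = 1"
proof -
  have bij: "bij_betw (\<lambda>i. (s + i) mod n) {..<n} {..<n}"
    using assms by (intro bij_betw_add_mod) simp
  then have "j \<in> (\<lambda>i. (s + i) mod n) ` {..<n}" using assms by (simp add: bij_betw_def)
  then obtain i where i: "i < n" "(s + i) mod n = j" by auto
  have inj: "inj_on (\<lambda>i. (s + i) mod n) {..<n}" using bij by (rule bij_betw_imp_inj_on)
  have "k = i" if "k < n" "(s + k) mod n = j" for k
    using inj_onD[OF inj, of k i] that i by simp
  then have "{i. i < n \<and> (i + s) mod n = j} = {i}"
    using i unfolding add.commute[of _ s] by blast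
  then show ?thesis by simp
qed

lemma add_mod_eq_self_iff:
  fixes n :: nat assumes "i < n" "s < n" shows "(i + s) mod n = i \<longleftrightarrow> s = 0"
proof
  assume "(i + s) mod n = i"
  then have "[i + s = i + 0] (mod n)" using assms by (simp add: cong_def)
  then have "[s = 0] (mod n)" by (simp only: cong_add_lcancel_nat)
  then show "s = 0" using assms by (simp add: cong_def)
qed (use assms in simp)

text \<open>The vertex \<open>j\<close> is reached from the indices \<open>j\<close> and
  \<open>j - s\<close>. These differ since \<open>s\<close> is nonzero modulo \<open>n\<close>; for
  \<open>s = n/2\<close> they count two parallel edges.\<close>

lemma card_edge_ends:
  fixes n :: nat assumes "j < n" "0 < s" "s < n"
  shows "card {i. i < n \<and> (j = i \<or> j = (i + s) mod n)} = 2"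
proof -
  have "{i. i < n \<and> (j = i \<or> j = (i + s) mod n)} = {j} \<union> {i. i < n \<and> (i + s) mod n = j}"
    using assms by auto
  moreover have "card ({j} \<union> {i. i < n \<and> (i + s) mod n = j}) = card {j} + card {i. i < n \<and> (i + s) mod n = j}"
    using assms add_mod_eq_self_iff by (intro card_Un_disjoint) auto
  ultimately show ?thesis using card_add_mod_eq[OF assms(1)] by simp
qed

lemma card_half_edge_ends:
  fixes n :: nat assumes "n = 2 * h" "j < n"
  shows "card {i. i < h \<and> (j = i \<or> j = (i + h) mod n)} = 1"
proof -
  have "{i. i < h \<and> (j = i \<or> j = (i + h) mod n)} = {if j < h then j else j - h}"
    using assms by auto
  then show ?thesis by simp
qed

section \<open>Adjacent letters of \<open>u\<close>: counts and nonzero differences\<close>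

lemma sdiff_eq_0_iff:
  assumes "i < n" "j < n" shows "sdiff n j i = 0 \<longleftrightarrow> i = j"
proof
  assume "sdiff n j i = 0"
  then show "i = j" using add_sdiff_mod[of n i 0 j] assms by simp
qed (simp add: sdiff_def)

text \<open>Each of the \<open>length u - 1\<close> adjacent pairs has exactly one sign
  pattern.\<close>

lemma size_ABQ: "u \<noteq> [] \<Longrightarrow> size (Abar' n u) + size (Bbar' n u) + size (Qbar n u) + 1 = length u"
proof (induction u rule: induct_list012)
  case (3 x y zs)
  then show ?case by (cases x; cases y) (simp_all add: Abar'_def Bbar'_def Qbar_def)
qed (simp_all add: Abar'_def Bbar'_def Qbar_def)

text \<open>Sign changes downwards and upwards alternate along \<open>u\<close>, so their numbers
  differ by what the signs of the first and last letters dictate.\<close>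

lemma size_AB:
  "u \<noteq> [] \<Longrightarrow> size (Abar' n u) + of_bool (\<not> positive (hd u)) =
    size (Bbar' n u) + of_bool (\<not> positive (last u))"
proof (induction u rule: induct_list012)
  case (3 x y zs)
  then show ?case by (cases x; cases y) (simp_all add: Abar'_def Bbar'_def)
qed (simp_all add: Abar'_def Bbar'_def)

lemma zip_tl_sublist: "p \<in> set (zip u (tl u)) \<Longrightarrow> sublist [fst p, snd p] u"
proof (induction u rule: induct_list012)
  case (3 x y zs)
  then show ?case
    by (auto simp: sublist_Cons_right)
qed simp_all

context star_word
begin

lemma zip_u_bounded:
  "p \<in> set (zip u (tl u)) \<Longrightarrow> set_letter (fst p) \<subseteq> {..<n} \<and> set_letter (snd p) \<subseteq> {..<n}"
  using u_bounded list.set_sel(2)[OF u_ne] set_zip_leftD[of "fst p" "snd p"] set_zip_rightD[of "fst p" "snd p"]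
  by simp

lemma zip_u_reduced: "p \<in> set (zip u (tl u)) \<Longrightarrow> snd p \<noteq> linv (fst p)"
  using u_reduced zip_tl_sublist unfolding reduced_def by metis

text \<open>A zero shift would come from a cancelling pair in the reduced word \<open>u\<close>;
  hence there are no loops.\<close>

lemma Abar'_bounds: assumes "s \<in># Abar' n u" shows "0 < s" "s < n"
proof -
  obtain i j where p: "(Pos i, Neg j) \<in> set (zip u (tl u))" and s: "s = sdiff n j i"
    using assms by (auto simp: Abar'_def split: letter.splits prod.splits)
  have "i \<noteq> j" using zip_u_reduced[OF p] by simp
  then show "0 < s" "s < n"
    using zip_u_bounded[OF p] sdiff_eq_0_iff[of i n j] sdiff_less[of n j i] by (auto simp: s)
qed

lemma Bbar'_bounds: assumes "s \<in># Bbar' n u" shows "0 < s" "s < n"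
proof -
  obtain i j where p: "(Neg i, Pos j) \<in> set (zip u (tl u))" and s: "s = sdiff n j i"
    using assms by (auto simp: Bbar'_def split: letter.splits prod.splits)
  have "i \<noteq> j" using zip_u_reduced[OF p] by simp
  then show "0 < s" "s < n"
    using zip_u_bounded[OF p] sdiff_eq_0_iff[of i n j] sdiff_less[of n j i] by (auto simp: s)
qed

text \<open>The degree is \<open>2 * size (Abar' n u) + size (Qbar n u) + half_pos\<close> at a
  positive vertex, and likewise with \<open>Bbar'\<close> and \<open>half_neg\<close> at a negative
  one. \<open>size_AB\<close> trades one copy of \<open>Abar'\<close> or \<open>Bbar'\<close> for
  the other, and \<open>size_ABQ\<close> then gives the length of \<open>u\<close>.\<close>

lemma regular_star_graph:
  "regular (length u) (star_graph (cyclic_pres n w))"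
  unfolding regular_def
proof
  let ?G = "star_graph (cyclic_pres n w)"
  fix v assume "v \<in> verts ?G"
  then have "v \<in> Pos ` {..<n} \<union> Neg ` {..<n}" by (simp add: star_graph_def cyclic_pres_def)
  then show "size (nbhd ?G v) = length u"
  proof (elim UnE imageE)
    fix j assume v: "v = Pos j" and "j \<in> {..<n}"
    then have j: "j < n" by simp
    have "size (nbhd ?G v) = 2 * size (Abar' n u) + 0 * size (Bbar' n u) + 1 * size (Qbar n u)
        + 1 * size (replicate_mset half_pos h) + 0 * size (replicate_mset half_neg h)"
      unfolding size_nbhd edges_formula filter_union_mset size_union v
      using card_edge_ends[OF j Abar'_bounds] card_half_edge_ends[OF n_eq j] j
      by (intro arg_cong2[of _ _ _ _ plus] size_shift_edges_at) (simp_all split: if_splits cong: conj_cong)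
    then show ?thesis using size_ABQ[OF u_ne, of n] size_AB[OF u_ne, of n]
      by (auto simp: half_pos_def split: if_splits)
  next
    fix j assume v: "v = Neg j" and "j \<in> {..<n}"
    then have j: "j < n" by simp
    have "size (nbhd ?G v) = 0 * size (Abar' n u) + 2 * size (Bbar' n u) + 1 * size (Qbar n u)
        + 0 * size (replicate_mset half_pos h) + 1 * size (replicate_mset half_neg h)"
      unfolding size_nbhd edges_formula filter_union_mset size_union v
      using card_edge_ends[OF j Bbar'_bounds] card_half_edge_ends[OF n_eq j] card_add_mod_eq[OF j]
      by (intro arg_cong2[of _ _ _ _ plus] size_shift_edges_at) (simp_all add: eq_commute[of j] split: if_splits)
    then show ?thesis using size_ABQ[OF u_ne, of n] size_AB[OF u_ne, of n]
      by (auto simp: half_neg_def split: if_splits)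
  qed
qed

end

section \<open>Connected components\<close>

lemma set_shift_edges:
  "e \<in># shift_edges n m S E \<longleftrightarrow> (\<exists>s\<in>#S. \<exists>i<m. e = E i ((i + s) mod n))"
  by (induction S) auto

section \<open>Subgroups of the integers and reachability by shifts\<close>

lemma int_subgroup_mult:
  fixes H :: "int set"
  assumes "0 \<in> H" "\<And>x y. x \<in> H \<Longrightarrow> y \<in> H \<Longrightarrow> x + y \<in> H" "\<And>x. x \<in> H \<Longrightarrow> - x \<in> H" "x \<in> H"
  shows "k * x \<in> H"
proof (induction k rule: int_induct[where k = 0])
  case base
  then show ?case using assms by simp
next
  case (step1 i)
  then show ?case using assms by (simp add: distrib_right)
next
  case (step2 i)
  then have "i * x + - x \<in> H" using assms by blast
  then show ?case by (simp add: left_diff_distrib)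
qed

text \<open>Bezout's identity, applied to one generator at a time.\<close>

lemma Gcd_mem_int_subgroup:
  fixes H :: "int set"
  assumes "0 \<in> H" "\<And>x y. x \<in> H \<Longrightarrow> y \<in> H \<Longrightarrow> x + y \<in> H" "\<And>x. x \<in> H \<Longrightarrow> - x \<in> H"
    and "finite X" "X \<subseteq> H"
  shows "Gcd X \<in> H"
  using assms(4,5)
proof (induction X)
  case empty
  then show ?case using assms(1) by simp
next
  case (insert x X)
  obtain a b where "a * x + b * Gcd X = gcd x (Gcd X)" using bezout_int by blast
  moreover have "a * x \<in> H" "b * Gcd X \<in> H"
    using int_subgroup_mult[of H] assms(1-3) insert by auto
  ultimately show ?case using assms(2) by (metis Gcd_insert)
qed

lemma adj_sym: "adj G x y \<Longrightarrow> adj G y x"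
  by (simp add: adj_def insert_commute)

lemma reach_sym: "(adj G)\<^sup>*\<^sup>* x y \<Longrightarrow> (adj G)\<^sup>*\<^sup>* y x"
proof (induction rule: rtranclp_induct)
  case (step y z)
  then show ?case by (metis adj_sym converse_rtranclp_into_rtranclp)
qed simp

lemma reach_invariant:
  assumes "(adj G)\<^sup>*\<^sup>* x y" "\<And>x y. {x, y} \<in># edges G \<Longrightarrow> f x = f y"
  shows "f x = f y"
  using assms(1) by induction (use assms(2) in \<open>auto simp: adj_def\<close>)

text \<open>Vertices of one sign, indexed periodically by all integers, so that walks compose by
  adding shifts of either sign; \<open>c\<close> is the constructor of the letter.\<close>

definition vtx :: "nat \<Rightarrow> (nat \<Rightarrow> 'v) \<Rightarrow> int \<Rightarrow> 'v" where
  "vtx n c z = c (nat (z mod int n))"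

lemma vtx_cong: "[x = y] (mod int n) \<Longrightarrow> vtx n c x = vtx n c y"
  by (simp add: vtx_def cong_def)

lemma vtx_of_nat: "i < n \<Longrightarrow> vtx n c (int i) = c i"
  by (simp add: vtx_def)

lemma vtx_add: "vtx n c (int i + int s) = c ((i + s) mod n)"
  by (simp add: vtx_def nat_mod_distrib flip: of_nat_add of_nat_mod)

text \<open>The shifts realisable by walks from every starting point form a subgroup: walks
  concatenate and reverse. It contains \<open>n\<close> and \<open>X\<close>, hence their gcd and
  all its multiples.\<close>

lemma reach_shift_Gcd:
  assumes "finite X" "0 < n"
    and step: "\<And>s x. s \<in> X \<Longrightarrow> (adj G)\<^sup>*\<^sup>* (vtx n c x) (vtx n c (x + s))"
    and "[x = y] (mod (Gcd (insert (int n) X)))"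
  shows "(adj G)\<^sup>*\<^sup>* (vtx n c x) (vtx n c y)"
proof -
  let ?H = "{z. \<forall>x. (adj G)\<^sup>*\<^sup>* (vtx n c x) (vtx n c (x + z))}"
  have 0: "0 \<in> ?H" by simp
  have add: "a + b \<in> ?H" if "a \<in> ?H" "b \<in> ?H" for a b
  proof clarify
    fix x
    have "(adj G)\<^sup>*\<^sup>* (vtx n c x) (vtx n c (x + a))" using that by blast
    also have "(adj G)\<^sup>*\<^sup>* (vtx n c (x + a)) (vtx n c (x + a + b))" using that by blast
    finally show "(adj G)\<^sup>*\<^sup>* (vtx n c x) (vtx n c (x + (a + b)))" by (simp add: add.assoc)
  qed
  \<comment> \<open>The walk for \<open>a\<close> that starts at \<open>x - a\<close> ends at
    \<open>x\<close>; it is traversed backwards.\<close>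
  have minus: "- a \<in> ?H" if "a \<in> ?H" for a
  proof clarify
    fix x
    have "(adj G)\<^sup>*\<^sup>* (vtx n c (x + - a)) (vtx n c (x + - a + a))" using that by blast
    then show "(adj G)\<^sup>*\<^sup>* (vtx n c x) (vtx n c (x + - a))" by (subst (asm) diff_add_cancel[of x a, unfolded diff_conv_add_uminus]) (rule reach_sym)
  qed
  have "int n \<in> ?H"
  proof clarify
    fix x
    have "vtx n c (x + int n) = vtx n c x" by (rule vtx_cong) (simp add: cong_def)
    then show "(adj G)\<^sup>*\<^sup>* (vtx n c x) (vtx n c (x + int n))" by simp
  qed
  moreover have "X \<subseteq> ?H" using step by blast
  ultimately have "Gcd (insert (int n) X) \<in> ?H"
    using Gcd_mem_int_subgroup[of ?H "insert (int n) X", OF 0 add minus] assms(1) by simp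
  moreover obtain k where "y = x + k * Gcd (insert (int n) X)"
    using assms(4) by (metis cong_iff_lin cong_sym mult.commute)
  ultimately have "k * Gcd (insert (int n) X) \<in> ?H"
    using int_subgroup_mult[of ?H, OF 0 add minus] by blast
  then show ?thesis using \<open>y = x + k * _\<close> by blast
qed

section \<open>Vertex sets as residue classes\<close>

lemma mem_shift_class_iff:
  fixes n d i j :: nat
  assumes "d dvd n" "0 < n"
  shows "(\<exists>t < n div d. i = (j + t * d) mod n) \<longleftrightarrow> i < n \<and> [i = j] (mod d)"
proof
  assume "\<exists>t < n div d. i = (j + t * d) mod n"
  then obtain t where "i = (j + t * d) mod n" by blast
  then have "[i = j + t * d] (mod d)" using assms(1) by (simp add: cong_def mod_mod_cancel)
  then show "i < n \<and> [i = j] (mod d)" using mod_less_divisor[OF assms(2)] \<open>i = _\<close>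
    by (simp add: cong_def)
next
  assume i: "i < n \<and> [i = j] (mod d)"
  obtain N where N: "n = d * N" using assms(1) by blast
  then have dN: "0 < d" "0 < N" using assms(2) by auto
  obtain c where c: "int i - int j = int d * c"
    using i by (metis cong_iff_dvd_diff cong_int_iff dvdE)
  \<comment> \<open>The quotient \<open>c\<close> of \<open>i - j\<close> by \<open>d\<close> may be
    negative, so it is reduced modulo \<open>N = n div d\<close>; this changes \<open>t * d\<close>
    only by a multiple of \<open>n\<close>.\<close>
  define t where "t = nat (c mod int N)"
  have t: "int t = c mod int N" using dN by (simp add: t_def)
  have "t < N" using dN by (simp add: t_def nat_less_iff)
  moreover have "i = (j + t * d) mod n"
  proof -
    have "int ((j + t * d) mod n) = (int j + c mod int N * int d) mod int n"
      unfolding zmod_int of_nat_add of_nat_mult t ..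
    also have "c mod int N * int d = (c * int d) mod int n"
      unfolding N of_nat_mult by (metis mult.commute mult_mod_right)
    also have "(int j + (c * int d) mod int n) mod int n = (int j + c * int d) mod int n"
      by (simp add: mod_simps)
    also have "int j + c * int d = int i" using c by (simp add: algebra_simps)
    also have "int i mod int n = int i" using i by simp
    finally show ?thesis by simp
  qed
  ultimately show "\<exists>t < n div d. i = (j + t * d) mod n" using N dN by auto
qed

lemma Vpos_eq: "d dvd n \<Longrightarrow> 0 < n \<Longrightarrow> Vpos n d j = Pos ` {i. i < n \<and> [i = j] (mod d)}"
  using mem_shift_class_iff[of d n _ j] unfolding Vpos_def by blast

lemma Vneg_eq: "d dvd n \<Longrightarrow> 0 < n \<Longrightarrow> Vneg n d j = Neg ` {i. i < n \<and> [i = j] (mod d)}"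
  using mem_shift_class_iff[of d n _ j] unfolding Vneg_def by blast

lemma card_shift_class:
  fixes n d j :: nat
  assumes "d dvd n" "0 < n"
  shows "card {i. i < n \<and> [i = j] (mod d)} = n div d"
proof -
  have "{i. i < n \<and> [i = j] (mod d)} = (\<lambda>t. (j + t * d) mod n) ` {..<n div d}"
    using mem_shift_class_iff[OF assms] by auto
  moreover have "inj_on (\<lambda>t. (j + t * d) mod n) {..<n div d}"
  proof (rule inj_onI)
    fix s t assume st: "s \<in> {..<n div d}" "t \<in> {..<n div d}" "(j + s * d) mod n = (j + t * d) mod n"
    obtain N where N: "n = d * N" using assms(1) by blast
    then have dN: "0 < d" "0 < N" using assms(2) by auto
    have "[j + s * d = j + t * d] (mod n)" using st by (simp add: cong_def)
    then have "[s * d = t * d] (mod n)" by (simp only: cong_add_lcancel_nat)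
    moreover have "s * d < n" "t * d < n" using st N dN by auto
    ultimately show "s = t" using dN by (simp add: cong_def)
  qed
  ultimately show ?thesis by (simp add: card_image)
qed

lemma components_eq:
  assumes "\<And>j. j \<in> I \<Longrightarrow> \<exists>x\<in>verts G. F j = {y \<in> verts G. (adj G)\<^sup>*\<^sup>* x y}"
    and "\<And>x. x \<in> verts G \<Longrightarrow> \<exists>j\<in>I. F j = {y \<in> verts G. (adj G)\<^sup>*\<^sup>* x y}"
  shows "components G = (\<lambda>j. induced G (F j)) ` I"
  unfolding components_def using assms by (auto simp: image_iff) metis+

lemma verts_induced [simp]: "verts (induced G U) = U"
  by (simp add: induced_def)

lemma induced_eq_iff: "induced G U = induced G U' \<longleftrightarrow> U = U'"
  by (metis verts_induced)

text \<open>The edge at \<open>i >= h\<close> repeats the one at \<open>i - h\<close> with its ends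
  exchanged. Apart from multiplicity, half and full orbits therefore agree.\<close>

lemma half_shift_all:
  fixes n h :: nat
  assumes "n = 2 * h" and comm: "\<And>i k. E i k = E k i"
  shows "(\<exists>i<h. e = E i ((i + h) mod n)) \<longleftrightarrow> (\<exists>i<n. e = E i ((i + h) mod n))"
proof
  assume "\<exists>i<n. e = E i ((i + h) mod n)"
  then obtain i where i: "i < n" "e = E i ((i + h) mod n)" by blast
  show "\<exists>i<h. e = E i ((i + h) mod n)"
  proof (cases "i < h")
    case False
    then have "(i + h) mod n = i - h" "(i - h + h) mod n = i"
      using i assms(1) by (auto simp: mod_if)
    then have "i - h < h" "e = E (i - h) ((i - h + h) mod n)"
      using i assms(1) comm False by auto
    then show ?thesis by blast
  qed (use i in blast)
next
  assume "\<exists>i<h. e = E i ((i + h) mod n)"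
  then obtain i where "i < h" "e = E i ((i + h) mod n)" by blast
  then show "\<exists>i<n. e = E i ((i + h) mod n)" using assms(1) by (intro exI[of _ i]) simp
qed

lemma vtx_obtain:
  assumes "0 < n"
  obtains i where "i < n" "\<And>c :: nat \<Rightarrow> 'v. vtx n c x = c i"
    "\<And>(c :: nat \<Rightarrow> 'v) s. vtx n c (x + int s) = c ((i + s) mod n)"
proof (rule that)
  let ?i = "nat (x mod int n)"
  show "?i < n" using assms by (simp add: nat_less_iff)
  show "vtx n c x = c ?i" for c :: "nat \<Rightarrow> 'v" by (simp add: vtx_def)
  have "[x + int s = int ?i + int s] (mod int n)" for s
    using assms by (simp add: cong_def mod_simps)
  then show "vtx n c (x + int s) = c ((?i + s) mod n)" for c :: "nat \<Rightarrow> 'v" and s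
    using vtx_cong vtx_add by metis
qed

lemma int_mod_add_dvd:
  fixes n d i s :: nat
  assumes "d dvd n" "d dvd s"
  shows "[(i + s) mod n = i] (mod d)"
proof -
  have "(i + s) mod n mod d = (i + s) mod d" using assms by (simp add: mod_mod_cancel)
  also have "\<dots> = i mod d" using assms by (auto elim!: dvdE)
  finally show ?thesis by (simp add: cong_def)
qed

lemma alternating_imp_Qbar_empty:
  assumes "alternating u" shows "Qbar n u = {#}"
proof -
  have "False" if "s \<in># Qbar n u" for s
  proof -
    have "\<exists>i j. (Pos i, Pos j) \<in> set (zip u (tl u)) \<or> (Neg j, Neg i) \<in> set (zip u (tl u))"
      using that by (fastforce simp: Qbar_def split: letter.splits prod.splits)
    then obtain i j where "sublist [Pos i, Pos j] u \<or> sublist [Neg j, Neg i] u"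
      using zip_tl_sublist by fastforce
    then show False using assms by (auto simp: alternating_def winv_def)
  qed
  then show ?thesis by (meson multiset_nonemptyE)
qed

section \<open>Components of the star graph in the two cases\<close>

context star_word
begin

abbreviation "G \<equiv> star_graph (cyclic_pres n w)"

lemma verts_G: "verts G = Pos ` {..<n} \<union> Neg ` {..<n}"
  by (simp add: star_graph_def cyclic_pres_def)

text \<open>Adjacency ignores multiplicity, so each half orbit may be read as a full orbit with
  shift \<open>h\<close>. This is why the gcds involve \<open>Abar\<close> and \<open>Bbar\<close>
  and not only \<open>Abar'\<close> and \<open>Bbar'\<close>.\<close>

lemma edge_iff:
  "e \<in># edges G \<longleftrightarrow>
    (\<exists>s\<in>#Abar n u. \<exists>i<n. e = {Pos i, Pos ((i + s) mod n)}) \<or>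
    (\<exists>s\<in>#Bbar n u. \<exists>i<n. e = {Neg i, Neg ((i + s) mod n)}) \<or>
    (\<exists>s\<in>#Qbar n u. \<exists>i<n. e = {Pos i, Neg ((i + s) mod n)})"
proof -
  have *: "e \<in># shift_edges n n S E \<or> e \<in># shift_edges n h (replicate_mset m h) E \<longleftrightarrow>
      (\<exists>s\<in>#S + replicate_mset m h. \<exists>i<n. e = E i ((i + s) mod n))"
    if "\<And>i k. E i k = E k i" for E S m
    using half_shift_all[OF n_eq, of E e] that unfolding set_shift_edges by auto
  show ?thesis
    unfolding edges_formula Abar_eq Bbar_eq
    using *[of Pos_edge "Abar' n u" half_pos] *[of Neg_edge "Bbar' n u" half_neg]
      set_shift_edges[of e n n "Qbar n u" mixed_edge]
    by (simp only: union_iff insert_commute) blast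
qed

lemma adj_vtx:
  shows "s \<in># Abar n u \<Longrightarrow> adj G (vtx n Pos x) (vtx n Pos (x + int s))"
    and "s \<in># Bbar n u \<Longrightarrow> adj G (vtx n Neg x) (vtx n Neg (x + int s))"
    and "s \<in># Qbar n u \<Longrightarrow> adj G (vtx n Pos x) (vtx n Neg (x + int s))"
proof -
  have "0 < n" using n2 by simp
  then obtain i where "i < n" "\<And>c :: nat \<Rightarrow> nat letter. vtx n c x = c i"
    "\<And>(c :: nat \<Rightarrow> nat letter) s. vtx n c (x + int s) = c ((i + s) mod n)"
    by (rule vtx_obtain[where 'v = "nat letter" and x = x]) blast
  then show "s \<in># Abar n u \<Longrightarrow> adj G (vtx n Pos x) (vtx n Pos (x + int s))"
    and "s \<in># Bbar n u \<Longrightarrow> adj G (vtx n Neg x) (vtx n Neg (x + int s))"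
    and "s \<in># Qbar n u \<Longrightarrow> adj G (vtx n Pos x) (vtx n Neg (x + int s))"
    unfolding adj_def edge_iff by auto
qed

lemma adj_cases:
  assumes "{x, y} \<in># edges G"
  obtains s i where "s \<in># Abar n u" "i < n" "{x, y} = {Pos i, Pos ((i + s) mod n)}"
  | s i where "s \<in># Bbar n u" "i < n" "{x, y} = {Neg i, Neg ((i + s) mod n)}"
  | s i where "s \<in># Qbar n u" "i < n" "{x, y} = {Pos i, Neg ((i + s) mod n)}"
  using assms unfolding edge_iff by blast

text \<open>Reachability is characterised by an invariant \<open>g\<close> modulo \<open>d\<close>.
  Edges preserve it, and every vertex can be walked to a positive vertex with the same
  \<open>g\<close>, where the gcd argument applies.\<close>

lemma components_not_alternating:
  assumes q0: "q0 \<in># Qbar n u" and d: "d = dQ n u q0"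
  shows "0 < d" "d dvd n"
    "bij_betw (\<lambda>j. induced G (Vpos n d j \<union> Vneg n d (j + q0))) {..<d} (components G)"
proof -
  let ?X = "int ` set_mset (Abar n u) \<union> int ` set_mset (Bbar n u)
      \<union> (\<lambda>q. int q - int q0) ` set_mset (Qbar n u)"
  have n0: "0 < n" using n2 by simp
  have Gcd: "int d = Gcd (insert (int n) ?X)"
    unfolding d dQ_def by simp
  have dvd: "int d dvd z" if "z \<in> insert (int n) ?X" for z
    unfolding Gcd using that by (rule Gcd_dvd)
  show dn: "d dvd n" using dvd[of "int n"] by simp
  then show d0: "0 < d" using n0 by (auto intro: Nat.gr0I)
  \<comment> \<open>Negative subscripts are corrected by \<open>q0\<close>, so that mixed edges of
    shift \<open>q0\<close> preserve \<open>g\<close> modulo \<open>n\<close>, and those of shift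
    \<open>q\<close> change it by \<open>q - q0\<close>.\<close>
  define g :: "nat letter \<Rightarrow> int" where "g v = (case v of Pos i \<Rightarrow> int i | Neg i \<Rightarrow> int i - int q0)" for v
  have inv: "g x mod int d = g y mod int d" if "(adj G)\<^sup>*\<^sup>* x y" for x y
    using that
  proof (rule reach_invariant)
    fix x y assume "{x, y} \<in># edges G"
    then show "g x mod int d = g y mod int d"
    proof (cases rule: adj_cases)
      case (1 s i)
      have "d dvd s" using dvd[of "int s"] 1 by simp
      then have "int ((i + s) mod n) mod int d = int i mod int d"
        using int_mod_add_dvd[OF dn] by (metis cong_def cong_int_iff)
      then show ?thesis using 1 by (auto simp: g_def doubleton_eq_iff)
    next
      case (2 s i)
      have "d dvd s" using dvd[of "int s"] 2 by simp
      then have "int ((i + s) mod n) mod int d = int i mod int d"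
        using int_mod_add_dvd[OF dn] by (metis cong_def cong_int_iff)
      then have "(int ((i + s) mod n) - int q0) mod int d = (int i - int q0) mod int d"
        by (metis mod_diff_left_eq)
      then show ?thesis using 2 by (auto simp: g_def doubleton_eq_iff)
    next
      case (3 s i)
      have "int d dvd int s - int q0" using dvd[of "int s - int q0"] 3 by blast
      moreover have "int d dvd int ((i + s) mod n) - (int i + int s)"
      proof -
        have "[(i + s) mod n = i + s] (mod d)" using dn by (simp add: cong_def mod_mod_cancel)
        then show ?thesis by (metis cong_iff_dvd_diff cong_int_iff of_nat_add)
      qed
      ultimately have "int d dvd (int ((i + s) mod n) - (int i + int s)) + (int s - int q0)"
        using dvd_add by blast
      then have "int d dvd (int ((i + s) mod n) - int q0) - int i"
        by (simp add: algebra_simps)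
      then have "(int ((i + s) mod n) - int q0) mod int d = int i mod int d"
        by (simp add: mod_eq_dvd_iff)
      then show ?thesis using 3 by (auto simp: g_def doubleton_eq_iff)
    qed
  qed
  have to_neg: "(adj G)\<^sup>*\<^sup>* (vtx n Pos x) (vtx n Neg (x + int q))" if "q \<in># Qbar n u" for x q
    using adj_vtx(3)[OF that] by blast
  have step: "(adj G)\<^sup>*\<^sup>* (vtx n Pos x) (vtx n Pos (x + s))" if "s \<in> ?X" for s x
    using that
  proof (elim UnE imageE)
    \<comment> \<open>Cross to the negative side along \<open>q0\<close>, move by \<open>b\<close>
      there, and return along \<open>q0\<close>.\<close>
    fix b assume b: "b \<in># Bbar n u" "s = int b"
    have "(adj G)\<^sup>*\<^sup>* (vtx n Pos x) (vtx n Neg (x + int q0))" by (rule to_neg[OF q0])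
    also have "(adj G)\<^sup>*\<^sup>* (vtx n Neg (x + int q0)) (vtx n Neg (x + int q0 + int b))"
      using adj_vtx(2)[OF b(1)] by blast
    also have "x + int q0 + int b = x + s + int q0" using b by simp
    also have "(adj G)\<^sup>*\<^sup>* (vtx n Neg (x + s + int q0)) (vtx n Pos (x + s))"
      by (rule reach_sym[OF to_neg[OF q0]])
    finally show ?thesis .
  next
    \<comment> \<open>Cross along \<open>q\<close> and return along \<open>q0\<close>; the net shift
      is \<open>q - q0\<close>.\<close>
    fix q assume q: "q \<in># Qbar n u" "s = int q - int q0"
    have "(adj G)\<^sup>*\<^sup>* (vtx n Pos x) (vtx n Neg (x + int q))" by (rule to_neg[OF q(1)])
    also have "x + int q = x + s + int q0" using q by simp
    also have "(adj G)\<^sup>*\<^sup>* (vtx n Neg (x + s + int q0)) (vtx n Pos (x + s))"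
      by (rule reach_sym[OF to_neg[OF q0]])
    finally show ?thesis .
  qed (use adj_vtx(1) in blast)
  have to_pos: "(adj G)\<^sup>*\<^sup>* v (vtx n Pos (g v))" if "v \<in> verts G" for v
  proof (cases v)
    case (Pos i)
    then show ?thesis using that by (auto simp: g_def verts_G vtx_of_nat)
  next
    case (Neg i)
    have "(adj G)\<^sup>*\<^sup>* (vtx n Pos (int i - int q0)) (vtx n Neg (int i - int q0 + int q0))"
      by (rule to_neg[OF q0])
    then show ?thesis using Neg that
      by (subst reach_sym) (auto simp: g_def verts_G vtx_of_nat)
  qed
  have reach_iff: "(adj G)\<^sup>*\<^sup>* x y \<longleftrightarrow> g x mod int d = g y mod int d"
    if "x \<in> verts G" "y \<in> verts G" for x y
  proof
    assume "g x mod int d = g y mod int d"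
    then have "[g x = g y] (mod Gcd (insert (int n) ?X))" unfolding Gcd[symmetric] cong_def .
    then have "(adj G)\<^sup>*\<^sup>* (vtx n Pos (g x)) (vtx n Pos (g y))"
      by (rule reach_shift_Gcd[OF _ n0 step, rotated 2]) simp_all
    then show "(adj G)\<^sup>*\<^sup>* x y"
      using to_pos that by (meson reach_sym rtranclp_trans)
  qed (rule inv)
  define F where "F j = Vpos n d j \<union> Vneg n d (j + q0)" for j
  have F: "F j = {y \<in> verts G. g y mod int d = int j mod int d}" for j
  proof -
    have "[i = j + q0] (mod d) \<longleftrightarrow> (int i - int q0) mod int d = int j mod int d" for i
      by (simp add: cong_iff_dvd_diff mod_eq_dvd_iff algebra_simps flip: cong_int_iff)
    moreover have "[i = j] (mod d) \<longleftrightarrow> int i mod int d = int j mod int d" for i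
      by (metis cong_def cong_int_iff)
    ultimately show ?thesis
      unfolding F_def Vpos_eq[OF dn n0] Vneg_eq[OF dn n0] verts_G by (auto simp: g_def)
  qed
  have cls: "{y \<in> verts G. (adj G)\<^sup>*\<^sup>* x y} = F j" if "x \<in> verts G" "g x mod int d = int j mod int d" for x j
    unfolding F using reach_iff that by auto
  \<comment> \<open>The positive vertices with subscripts \<open>j < d\<close> represent the
    classes, one each.\<close>
  have Pos_cls: "Pos j \<in> verts G" "g (Pos j) mod int d = int j mod int d" if "j < d" for j
    using that dvd_imp_le[OF dn n0] by (auto simp: verts_G g_def)
  have "components G = (\<lambda>j. induced G (F j)) ` {..<d}"
  proof (rule components_eq)
    fix j assume "j \<in> {..<d}"
    then show "\<exists>x\<in>verts G. F j = {y \<in> verts G. (adj G)\<^sup>*\<^sup>* x y}"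
      using Pos_cls[of j] cls[of "Pos j" j] by blast
  next
    fix x assume x: "x \<in> verts G"
    have "nat (g x mod int d) < d" "g x mod int d = int (nat (g x mod int d)) mod int d"
      using d0 by (simp_all add: nat_less_iff)
    then show "\<exists>j\<in>{..<d}. F j = {y \<in> verts G. (adj G)\<^sup>*\<^sup>* x y}"
      using cls[OF x] by blast
  qed
  moreover have "inj_on (\<lambda>j. induced G (F j)) {..<d}"
  proof (rule inj_onI)
    fix i j assume ij: "i \<in> {..<d}" "j \<in> {..<d}" "induced G (F i) = induced G (F j)"
    then have "F i = F j" by (simp only: induced_eq_iff)
    moreover have "Pos i \<in> F i" unfolding F using Pos_cls ij by auto
    ultimately have "Pos i \<in> F j" by simp
    then show "i = j" unfolding F using ij by (simp add: g_def flip: of_nat_mod)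
  qed
  ultimately show "bij_betw (\<lambda>j. induced G (Vpos n d j \<union> Vneg n d (j + q0))) {..<d} (components G)"
    by (simp add: bij_betw_def F_def)
qed

text \<open>Without mixed edges the sign is itself invariant, and each sign is governed by its own
  gcd; the invariant is the sign together with the residue modulo \<open>a\<close> or
  \<open>b\<close>.\<close>

lemma components_alternating:
  assumes Q: "Qbar n u = {#}" and a: "a = dA n u" and b: "b = dB n u"
  shows "0 < a" "a dvd n" "0 < b" "b dvd n"
    "components G = (\<lambda>j. induced G (Vpos n a j)) ` {..<a} \<union> (\<lambda>j. induced G (Vneg n b j)) ` {..<b}"
proof -
  have n0: "0 < n" using n2 by simp
  show an: "a dvd n" and bn: "b dvd n" unfolding a b dA_def dB_def by (rule Gcd_dvd, simp)+
  then show a0: "0 < a" and b0: "0 < b" using n0 by (auto intro: Nat.gr0I)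
  \<comment> \<open>The gcds are transferred to the integers, where the subgroup argument is
    stated.\<close>
  have "int a = Gcd (int ` insert n (set_mset (Abar n u)))"
    and "int b = Gcd (int ` insert n (set_mset (Bbar n u)))"
    unfolding a b dA_def dB_def by (rule Gcd_int_eq[symmetric])+
  then have Gcda: "int a = Gcd (insert (int n) (int ` set_mset (Abar n u)))"
    and Gcdb: "int b = Gcd (insert (int n) (int ` set_mset (Bbar n u)))"
    by simp_all
  have dvda: "a dvd s" if "s \<in># Abar n u" for s
    unfolding a dA_def using that by (intro Gcd_dvd) simp
  have dvdb: "b dvd s" if "s \<in># Bbar n u" for s
    unfolding b dB_def using that by (intro Gcd_dvd) simp
  define g :: "nat letter \<Rightarrow> bool \<times> nat" where
    "g v = (case v of Pos i \<Rightarrow> (True, i mod a) | Neg i \<Rightarrow> (False, i mod b))" for v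
  have inv: "g x = g y" if "(adj G)\<^sup>*\<^sup>* x y" for x y
    using that
  proof (rule reach_invariant)
    fix x y assume "{x, y} \<in># edges G"
    then show "g x = g y"
    proof (cases rule: adj_cases)
      case (1 s i)
      then have "(i + s) mod n mod a = i mod a"
        using int_mod_add_dvd[OF an dvda] unfolding cong_def by blast
      then show ?thesis using 1 by (auto simp: g_def doubleton_eq_iff)
    next
      case (2 s i)
      then have "(i + s) mod n mod b = i mod b"
        using int_mod_add_dvd[OF bn dvdb] unfolding cong_def by blast
      then show ?thesis using 2 by (auto simp: g_def doubleton_eq_iff)
    qed (use Q in simp)
  qed
  have reach_pos: "(adj G)\<^sup>*\<^sup>* (Pos i) (Pos k)" if "i < n" "k < n" "i mod a = k mod a" for i k
  proof -
    have "[int i = int k] (mod Gcd (insert (int n) (int ` set_mset (Abar n u))))"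
      using that unfolding Gcda[symmetric] cong_int_iff by (simp add: cong_def)
    then have "(adj G)\<^sup>*\<^sup>* (vtx n Pos (int i)) (vtx n Pos (int k))"
      by (rule reach_shift_Gcd[OF _ n0, rotated 2]) (use adj_vtx(1) in auto)
    then show ?thesis using that by (simp add: vtx_of_nat)
  qed
  have reach_neg: "(adj G)\<^sup>*\<^sup>* (Neg i) (Neg k)" if "i < n" "k < n" "i mod b = k mod b" for i k
  proof -
    have "[int i = int k] (mod Gcd (insert (int n) (int ` set_mset (Bbar n u))))"
      using that unfolding Gcdb[symmetric] cong_int_iff by (simp add: cong_def)
    then have "(adj G)\<^sup>*\<^sup>* (vtx n Neg (int i)) (vtx n Neg (int k))"
      by (rule reach_shift_Gcd[OF _ n0, rotated 2]) (use adj_vtx(2) in auto)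
    then show ?thesis using that by (simp add: vtx_of_nat)
  qed
  have reach_iff: "(adj G)\<^sup>*\<^sup>* x y \<longleftrightarrow> g x = g y" if "x \<in> verts G" "y \<in> verts G" for x y
    using inv[of x y] reach_pos reach_neg that by (cases x; cases y) (auto simp: g_def verts_G)
  have cls_pos: "{y \<in> verts G. (adj G)\<^sup>*\<^sup>* (Pos i) y} = Vpos n a j" if "i < n" "i mod a = j mod a" for i j
  proof -
    have "Pos i \<in> verts G" using that by (simp add: verts_G)
    then have "{y \<in> verts G. (adj G)\<^sup>*\<^sup>* (Pos i) y} = {y \<in> verts G. g (Pos i) = g y}"
      using reach_iff by blast
    also have "\<dots> = Vpos n a j"
      using that unfolding Vpos_eq[OF an n0] verts_G by (auto simp: g_def cong_def)
    finally show ?thesis .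
  qed
  have cls_neg: "{y \<in> verts G. (adj G)\<^sup>*\<^sup>* (Neg i) y} = Vneg n b j" if "i < n" "i mod b = j mod b" for i j
  proof -
    have "Neg i \<in> verts G" using that by (simp add: verts_G)
    then have "{y \<in> verts G. (adj G)\<^sup>*\<^sup>* (Neg i) y} = {y \<in> verts G. g (Neg i) = g y}"
      using reach_iff by blast
    also have "\<dots> = Vneg n b j"
      using that unfolding Vneg_eq[OF bn n0] verts_G by (auto simp: g_def cong_def)
    finally show ?thesis .
  qed
  have le: "a \<le> n" "b \<le> n" using an bn n0 by (auto intro: dvd_imp_le)
  let ?F = "case_sum (Vpos n a) (Vneg n b)"
  have "components G = (\<lambda>j. induced G (?F j)) ` ({..<a} <+> {..<b})"
  proof (rule components_eq)
    fix j assume "j \<in> {..<a} <+> {..<b}"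
    then show "\<exists>x\<in>verts G. ?F j = {y \<in> verts G. (adj G)\<^sup>*\<^sup>* x y}"
    proof
      fix i assume i: "i \<in> {..<a}" "j = Inl i"
      then have "Pos i \<in> verts G" "?F j = {y \<in> verts G. (adj G)\<^sup>*\<^sup>* (Pos i) y}"
        using cls_pos[of i i] le by (auto simp: verts_G)
      then show ?thesis by blast
    next
      fix i assume i: "i \<in> {..<b}" "j = Inr i"
      then have "Neg i \<in> verts G" "?F j = {y \<in> verts G. (adj G)\<^sup>*\<^sup>* (Neg i) y}"
        using cls_neg[of i i] le by (auto simp: verts_G)
      then show ?thesis by blast
    qed
  next
    fix x assume "x \<in> verts G"
    then consider i where "x = Pos i" "i < n" | i where "x = Neg i" "i < n"
      by (auto simp: verts_G)
    then show "\<exists>j\<in>{..<a} <+> {..<b}. ?F j = {y \<in> verts G. (adj G)\<^sup>*\<^sup>* x y}"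
    proof cases
      case 1
      then show ?thesis using cls_pos[of i "i mod a"] a0
        by (intro bexI[of _ "Inl (i mod a)"]) auto
    next
      case 2
      then show ?thesis using cls_neg[of i "i mod b"] b0
        by (intro bexI[of _ "Inr (i mod b)"]) auto
    qed
  qed
  then show "components G = (\<lambda>j. induced G (Vpos n a j)) ` {..<a} \<union> (\<lambda>j. induced G (Vneg n b j)) ` {..<b}"
    by (simp add: Plus_def image_Un image_image)
qed

end

section \<open>Circulant components\<close>

text \<open>The natural parametrisation runs from the circulant graph to the component, so the
  isomorphism is obtained as its inverse; \<open>sub\<close> ensures that the inverse recovers every
  edge.\<close>

lemma mgraph_isoI:
  assumes bij: "bij_betw \<phi> (verts H) (verts G)"
    and edges: "image_mset (image \<phi>) (edges H) = edges G"
    and sub: "\<And>e. e \<in># edges H \<Longrightarrow> e \<subseteq> verts H"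
  shows "mgraph_iso G H"
  unfolding mgraph_iso_def
proof (intro exI conjI)
  let ?f = "inv_into (verts H) \<phi>"
  show "bij_betw ?f (verts G) (verts H)" by (rule bij_betw_inv_into[OF bij])
  have "image_mset (image ?f) (edges G) = image_mset (\<lambda>e. ?f ` \<phi> ` e) (edges H)"
    by (simp flip: edges add: multiset.map_comp comp_def)
  also have "\<dots> = image_mset (\<lambda>e. e) (edges H)"
    using sub bij by (intro image_mset_cong) (auto simp: bij_betw_def inv_into_image_cancel)
  finally show "image_mset (image ?f) (edges G) = edges H" by simp
qed

text \<open>A bijection of vertices is injective on sets of vertices, so it commutes with merging
  parallel edges.\<close>

lemma mgraph_iso_underlying:
  assumes iso: "mgraph_iso G H" and sub: "\<And>e. e \<in># edges G \<Longrightarrow> e \<subseteq> verts G"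
  shows "mgraph_iso (underlying G) (underlying H)"
proof -
  obtain f where f: "bij_betw f (verts G) (verts H)" "image_mset (image f) (edges G) = edges H"
    using iso by (auto simp: mgraph_iso_def)
  have "inj_on (image f) (Pow (verts G))" using f(1) by (simp add: bij_betw_def inj_on_image_Pow)
  then have "inj_on (image f) (set_mset (edges G))" by (rule inj_on_subset) (use sub in blast)
  then have "image_mset (image f) (mset_set (set_mset (edges G))) = mset_set (set_mset (edges H))"
    by (simp add: image_mset_mset_set flip: f(2))
  then show ?thesis using f(1) by (auto simp: mgraph_iso_def underlying_def)
qed

lemma underlying_cong:
  fixes G H :: "'v mgraph"
  assumes "verts G = verts H" "set_mset (edges G) = set_mset (edges H)"
  shows "underlying G = underlying H"
  using assms by (simp add: underlying_def)

section \<open>Circulant graphs and deletion of antipodal edges\<close>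

definition circ_part :: "nat \<Rightarrow> nat \<Rightarrow> nat multiset \<Rightarrow> nat set multiset" where
  "circ_part N m S = (\<Sum>s\<in>#S. {# {i, (i + s) mod N}. i \<in># mset_set {..<m} #})"

lemma circ_part_simps [simp]:
  "circ_part N m {#} = {#}"
  "circ_part N m (add_mset s S) = {# {i, (i + s) mod N}. i \<in># mset_set {..<m} #} + circ_part N m S"
  "circ_part N m (S + S') = circ_part N m S + circ_part N m S'"
  by (simp_all add: circ_part_def)

lemma circ_part_replicate:
  "circ_part N m (replicate_mset k s) = repeat_mset k {# {i, (i + s) mod N}. i \<in># mset_set {..<m} #}"
  by (induction k) simp_all

lemma set_mset_repeat_mset: "0 < k \<Longrightarrow> set_mset (repeat_mset k A) = set_mset A"
  by (simp add: set_eq_iff flip: count_greater_zero_iff)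

lemma edges_circ: "edges (circ N A) = circ_part N N A"
  by (simp add: circ_def circ_part_def)

lemma edges_circ_subset: "0 < N \<Longrightarrow> e \<in># circ_part N N A \<Longrightarrow> e \<subseteq> {..<N}"
  by (induction A) auto

text \<open>Splitting the starting points of each antipodal shift at \<open>M\<close> leaves the
  lower half after deletion, which matches the half orbits of the star graph.\<close>

lemma edges_circ_del:
  assumes "k = 0 \<or> N = 2 * M"
  shows "edges (circ_del k N (A + replicate_mset k M)) = circ_part N N A + circ_part N M (replicate_mset k M)"
proof (cases "k = 0")
  case False
  then have N: "N = 2 * M" using assms by simp
  have "mset_set {..<N} = mset_set {..<M} + mset_set {M..<N}"
    using N by (subst mset_set_Union[symmetric]) (auto intro!: arg_cong[of _ _ mset_set])
  moreover have "N div 2 = M" using N by simp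
  ultimately show ?thesis
    by (simp add: circ_del_def edges_circ circ_part_replicate)
qed (simp add: circ_del_def edges_circ)

text \<open>Every deleted antipodal edge has a surviving parallel copy that starts at the opposite
  vertex, so only multiplicities drop.\<close>

lemma set_edges_circ_del:
  assumes "k = 0 \<or> N = 2 * M"
  shows "set_mset (edges (circ_del k N (A + replicate_mset k M))) = set_mset (edges (circ N (A + replicate_mset k M)))"
proof (cases "k = 0")
  case False
  then have N: "N = 2 * M" using assms by simp
  have "(\<lambda>i. {i, (i + M) mod N}) ` {..<M} = (\<lambda>i. {i, (i + M) mod N}) ` {..<N}"
  proof (intro equalityI subsetI; elim imageE)
    fix e i assume e: "e = {i, (i + M) mod N}" and i: "i \<in> {..<N}"
    show "e \<in> (\<lambda>i. {i, (i + M) mod N}) ` {..<M}"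
    proof (cases "i < M")
      case False
      then have "e = {i - M, (i - M + M) mod N}" "i - M < M" using e i N by (auto simp: mod_if)
      then show ?thesis by blast
    qed (use e in auto)
  qed (use N in auto)
  then show ?thesis unfolding edges_circ_del[OF assms] edges_circ
    using False by (simp add: circ_part_replicate set_mset_repeat_mset)
qed (simp add: circ_del_def)

lemma verts_circ_del [simp]: "verts (circ_del k N A) = {..<N}"
  by (simp add: circ_del_def circ_def)

lemma circ'_eq_circ_del:
  "even N \<Longrightarrow> N div 2 \<in># A \<Longrightarrow> circ' N A = circ_del 1 N A"
  by (simp add: circ'_def)

lemma underlying_circ':
  assumes "k = 0 \<or> N = 2 * M"
  shows "underlying (circ' N (A + replicate_mset k M)) = underlying (circ_del k N (A + replicate_mset k M))"
proof -
  have "set_mset (edges (circ' N B)) = set_mset (edges (circ N B))" for B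
  proof (cases "even N \<and> N div 2 \<in># B")
    case True
    then obtain B' where "B = add_mset (N div 2) B'" by (metis multi_member_split)
    then have "B = B' + replicate_mset 1 (N div 2)" by simp
    then show ?thesis using set_edges_circ_del[of 1 N "N div 2" B'] True by (auto simp: circ'_def)
  qed (auto simp: circ'_def)
  moreover have "verts (circ' N B) = {..<N}" for B
    by (simp add: circ'_def) (simp add: circ_def)
  ultimately show ?thesis using set_edges_circ_del[OF assms]
    by (intro underlying_cong) simp_all
qed

section \<open>Edges of the star graph within one residue class\<close>

lemma bij_betw_residue:
  fixes a M j :: nat
  assumes "j < a"
  shows "bij_betw (\<lambda>t. j + t * a) {..<M} {i. i < a * M \<and> i mod a = j}"
proof -
  have "inj_on (\<lambda>t. j + t * a) {..<M}" using assms by (auto intro!: inj_onI)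
  moreover have "(\<lambda>t. j + t * a) ` {..<M} = {i. i < a * M \<and> i mod a = j}"
  proof (intro equalityI subsetI)
    fix i assume "i \<in> {i. i < a * M \<and> i mod a = j}"
    then have i: "i < a * M" "i mod a = j" by auto
    then have "i div a < M" using less_mult_imp_div_less[of i M a] by (simp add: mult.commute)
    moreover have "i = j + i div a * a" using i by (metis add.commute div_mult_mod_eq)
    ultimately show "i \<in> (\<lambda>t. j + t * a) ` {..<M}" by blast
  next
    fix i assume "i \<in> (\<lambda>t. j + t * a) ` {..<M}"
    then obtain t where t: "t < M" "i = j + t * a" by blast
    have "j + t * a < Suc t * a" using assms by simp
    also have "\<dots> \<le> M * a" using t by (intro mult_le_mono1) simp
    finally show "i \<in> {i. i < a * M \<and> i mod a = j}" using t assms by (simp add: mult.commute)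
  qed
  ultimately show ?thesis by (simp add: bij_betw_def)
qed

text \<open>Under \<open>t\<close> going to \<open>j + t * a\<close>, shifting by
  \<open>a * s\<close> modulo \<open>a * N\<close> becomes shifting by \<open>s\<close> modulo
  \<open>N\<close>.\<close>

lemma residue_shift_mod:
  fixes a N j s t :: nat
  assumes "j < a"
  shows "(j + t * a + a * s) mod (a * N) = j + (t + s) mod N * a"
proof -
  have "(j + (t + s) * a) div a = t + s" "(j + (t + s) * a) mod a = j" using assms by simp_all
  then have "(j + (t + s) * a) mod (a * N) = j + (t + s) mod N * a"
    unfolding mod_mult2_eq by (simp add: mult.commute)
  moreover have "j + t * a + a * s = j + (t + s) * a" by (simp add: algebra_simps)
  ultimately show ?thesis by (simp only:)
qed

text \<open>Shifts divisible by \<open>a\<close> preserve residues, so an edge lies in the class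
  exactly when its starting point does. The bound \<open>m = a * M\<close> covers full orbits
  (\<open>M = N\<close>) and half orbits (\<open>M = N div 2\<close>) alike.\<close>

lemma filter_shift_edges:
  fixes c :: "nat \<Rightarrow> nat letter"
  assumes n: "n = a * N" and m: "m = a * M" "M \<le> N" and j: "j < a" and inj: "inj c"
    and S: "\<And>s. s \<in># S \<Longrightarrow> a dvd s"
  shows "filter_mset (\<lambda>e. e \<subseteq> c ` {i. i < n \<and> [i = j] (mod a)}) (shift_edges n m S (\<lambda>i k. {c i, c k})) =
    image_mset (image (\<lambda>t. c (j + t * a))) (circ_part N M (image_mset (\<lambda>s. s div a) S))"
  using S
proof (induction S)
  case (add s S)
  let ?V = "c ` {i. i < n \<and> [i = j] (mod a)}"
  obtain s' where s: "s = a * s'" using add.prems by (meson dvdE union_single_eq_member)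
  have "m \<le> n" using n m by simp
  have V: "{c i, c ((i + s) mod n)} \<subseteq> ?V \<longleftrightarrow> i mod a = j" if "i < m" for i
  proof -
    have "c i \<in> ?V \<longleftrightarrow> i mod a = j"
      using that \<open>m \<le> n\<close> j inj by (auto simp: cong_def dest: injD)
    moreover have "c ((i + s) mod n) \<in> ?V" if "i mod a = j"
    proof -
      have "(i + s) mod n mod a = j" using that n s by (simp add: mod_mod_cancel)
      moreover have "(i + s) mod n < n" using \<open>i < m\<close> \<open>m \<le> n\<close> by simp
      ultimately show ?thesis using j by (auto simp: cong_def)
    qed
    ultimately show ?thesis by auto
  qed
  have "filter_mset (\<lambda>e. e \<subseteq> ?V) (image_mset (\<lambda>i. {c i, c ((i + s) mod n)}) (mset_set {..<m})) =
      image_mset (\<lambda>i. {c i, c ((i + s) mod n)}) (mset_set {i. i < m \<and> i mod a = j})"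
  proof -
    have "{i \<in> {..<m}. {c i, c ((i + s) mod n)} \<subseteq> ?V} = {i. i < m \<and> i mod a = j}"
      using V by blast
    then show ?thesis by (simp only: filter_mset_image_mset filter_mset_mset_set finite_lessThan)
  qed
  also have "\<dots> = image_mset (\<lambda>t. {c (j + t * a), c ((j + t * a + s) mod n)}) (mset_set {..<M})"
    unfolding m by (rule image_mset_mset_set_bij[OF bij_betw_residue[OF j], symmetric])
  also have "\<dots> = image_mset (\<lambda>t. (\<lambda>t. c (j + t * a)) ` {t, (t + s') mod N}) (mset_set {..<M})"
    unfolding n s residue_shift_mod[OF j] by simp
  finally show ?case using add j s
    by (simp add: multiset.map_comp comp_def)
qed simp

lemma filter_shift_edges_none:
  assumes "\<And>i k. \<not> E i k \<subseteq> V"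
  shows "filter_mset (\<lambda>e. e \<subseteq> V) (shift_edges n m S E) = {#}"
proof -
  have "set_mset (filter_mset (\<lambda>e. e \<subseteq> V) (shift_edges n m S E)) = {}"
    using assms by (auto simp: set_shift_edges)
  then show ?thesis by (simp only: set_mset_eq_empty_iff)
qed

text \<open>Treats both signs at once through the constructor \<open>c\<close>; \<open>k\<close> is
  the number of half orbits, hence the number of antipodal copies to delete from the circulant
  graph.\<close>

lemma circulant_component:
  fixes c :: "nat \<Rightarrow> nat letter"
  assumes n: "n = 2 * h" "0 < h" and a: "a dvd n" and j: "j < a" and inj: "inj c"
    and A: "\<And>s. s \<in># A + replicate_mset k h \<Longrightarrow> a dvd s"
    and V: "V = c ` {i. i < n \<and> [i = j] (mod a)}"
    and edges: "filter_mset (\<lambda>e. e \<subseteq> V) (edges G) =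
      filter_mset (\<lambda>e. e \<subseteq> V) (shift_edges n n A (\<lambda>i k. {c i, c k}))
      + filter_mset (\<lambda>e. e \<subseteq> V) (shift_edges n h (replicate_mset k h) (\<lambda>i k. {c i, c k}))"
  defines "B \<equiv> image_mset (\<lambda>s. s div a) (A + replicate_mset k h)"
  shows "mgraph_iso (induced G V) (circ_del k (n div a) B)"
    and "mgraph_iso (underlying (induced G V)) (underlying (circ' (n div a) B))"
    and "k = 1 \<Longrightarrow> mgraph_iso (induced G V) (circ' (n div a) B)"
proof -
  let ?N = "n div a" and ?M = "h div a" and ?A = "image_mset (\<lambda>s. s div a) A"
  let ?\<phi> = "\<lambda>t. c (j + t * a)"
  have nN: "n = a * ?N" using a by simp
  have N0: "0 < ?N" using nN n by (metis gr0I mult_is_0 less_numeral_extra(3) zero_neq_numeral)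
  \<comment> \<open>Once \<open>h\<close> occurs as a shift, \<open>a\<close> divides
    \<open>h\<close>, so the component has an even number of vertices and \<open>h\<close> becomes
    its antipodal shift. For \<open>k = 0\<close> this can fail.\<close>
  have kM: "h = a * ?M \<and> ?N = 2 * ?M" if "k \<noteq> 0"
  proof -
    have "a dvd h" using A that by (simp add: in_replicate_mset)
    then show ?thesis using n by (auto elim!: dvdE)
  qed
  have B: "B = ?A + replicate_mset k ?M" by (simp add: B_def)
  have k: "k = 0 \<or> ?N = 2 * ?M" using kM by blast
  have "filter_mset (\<lambda>e. e \<subseteq> V) (shift_edges n n A (\<lambda>i k. {c i, c k})) =
      image_mset (image ?\<phi>) (circ_part ?N ?N ?A)"
    unfolding V using A by (intro filter_shift_edges nN j inj) auto
  moreover have "filter_mset (\<lambda>e. e \<subseteq> V) (shift_edges n h (replicate_mset k h) (\<lambda>i k. {c i, c k})) =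
      image_mset (image ?\<phi>) (circ_part ?N ?M (replicate_mset k ?M))"
  proof (cases "k = 0")
    case False
    have "filter_mset (\<lambda>e. e \<subseteq> V) (shift_edges n h (replicate_mset k h) (\<lambda>i k. {c i, c k})) =
      image_mset (image ?\<phi>) (circ_part ?N ?M (image_mset (\<lambda>s. s div a) (replicate_mset k h)))"
      unfolding V using A kM[OF False] by (intro filter_shift_edges nN j inj) auto
    then show ?thesis by simp
  qed simp
  ultimately have img: "image_mset (image ?\<phi>) (edges (circ_del k ?N B)) = edges (induced G V)"
    unfolding B edges_circ_del[OF k] by (simp add: induced_def edges)
  have "bij_betw (\<lambda>t. j + t * a) {..<?N} {i. i < n \<and> i mod a = j}"
    using bij_betw_residue[OF j, of ?N] nN by simp
  moreover have "bij_betw c {i. i < n \<and> i mod a = j} V"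
    using inj j by (auto simp: V bij_betw_def cong_def intro: inj_on_subset)
  ultimately have bij: "bij_betw ?\<phi> (verts (circ_del k ?N B)) (verts (induced G V))"
    using bij_betw_trans by (fastforce simp: comp_def)
  have sub: "e \<subseteq> verts (circ_del k ?N B)" if "e \<in># edges (circ_del k ?N B)" for e
    using that edges_circ_subset[OF N0, of e B]
    by (auto simp: circ_del_def circ_def edges_circ[symmetric] dest!: in_diffD)
  show iso: "mgraph_iso (induced G V) (circ_del k ?N B)"
    by (rule mgraph_isoI[OF bij img sub])
  have "mgraph_iso (underlying (induced G V)) (underlying (circ_del k ?N B))"
    using iso by (rule mgraph_iso_underlying) (simp add: induced_def)
  then show "mgraph_iso (underlying (induced G V)) (underlying (circ' ?N B))"
    using underlying_circ'[OF k, of ?A] by (simp add: B)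
  show "mgraph_iso (induced G V) (circ' ?N B)" if "k = 1"
  proof -
    \<comment> \<open>The single copy of the antipodal shift puts \<open>circ'\<close> into its
      deleting branch.\<close>
    have "even ?N" "?N div 2 \<in># B" using kM that by (auto simp: B)
    then show ?thesis using iso that by (simp add: circ'_eq_circ_del)
  qed
qed

section \<open>Isomorphism types of the components and conclusion\<close>

context star_word
begin

lemma filter_edges_Pos:
  assumes "Qbar n u = {#}"
  shows "filter_mset (\<lambda>e. e \<subseteq> Pos ` W) (edges G) =
      filter_mset (\<lambda>e. e \<subseteq> Pos ` W) (shift_edges n n (Abar' n u) Pos_edge)
      + filter_mset (\<lambda>e. e \<subseteq> Pos ` W) (shift_edges n h (replicate_mset half_pos h) Pos_edge)"
proof -
  have "filter_mset (\<lambda>e. e \<subseteq> Pos ` W) (shift_edges n m S Neg_edge) = {#}" for m S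
    by (rule filter_shift_edges_none) auto
  then show ?thesis by (simp add: edges_formula assms)
qed

lemma filter_edges_Neg:
  assumes "Qbar n u = {#}"
  shows "filter_mset (\<lambda>e. e \<subseteq> Neg ` W) (edges G) =
      filter_mset (\<lambda>e. e \<subseteq> Neg ` W) (shift_edges n n (Bbar' n u) Neg_edge)
      + filter_mset (\<lambda>e. e \<subseteq> Neg ` W) (shift_edges n h (replicate_mset half_neg h) Neg_edge)"
proof -
  have "filter_mset (\<lambda>e. e \<subseteq> Neg ` W) (shift_edges n m S Pos_edge) = {#}" for m S
    by (rule filter_shift_edges_none) auto
  then show ?thesis by (simp add: edges_formula assms)
qed

lemma component_iso_Pos:
  assumes Q: "Qbar n u = {#}" and j: "j < dA n u"
  defines "a \<equiv> dA n u"
  defines "A \<equiv> image_mset (\<lambda>s. s div a) (Abar n u)"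
  shows "mgraph_iso (induced G (Vpos n a j)) (circ_del half_pos (n div a) A)"
    and "mgraph_iso (underlying (induced G (Vpos n a j))) (underlying (circ' (n div a) A))"
    and "half_pos = 1 \<Longrightarrow> mgraph_iso (induced G (Vpos n a j)) (circ' (n div a) A)"
proof -
  have n0: "0 < n" using n2 by simp
  note an = components_alternating(2)[OF Q refl refl]
  have inj: "inj (Pos :: nat \<Rightarrow> nat letter)" by (simp add: inj_def)
  have dvd: "dA n u dvd s" if "s \<in># Abar' n u + replicate_mset half_pos h" for s
    unfolding dA_def using that Abar_eq by (intro Gcd_dvd) simp
  note iso = circulant_component[where G = G, OF n_eq h_pos an j inj dvd Vpos_eq[OF an n0]
      filter_edges_Pos[OF Q, of "{i. i < n \<and> [i = j] (mod dA n u)}", folded Vpos_eq[OF an n0]]]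
  show "mgraph_iso (induced G (Vpos n a j)) (circ_del half_pos (n div a) A)"
    and "mgraph_iso (underlying (induced G (Vpos n a j))) (underlying (circ' (n div a) A))"
    and "half_pos = 1 \<Longrightarrow> mgraph_iso (induced G (Vpos n a j)) (circ' (n div a) A)"
    using iso unfolding a_def A_def Abar_eq by blast+
qed

lemma component_iso_Neg:
  assumes Q: "Qbar n u = {#}" and j: "j < dB n u"
  defines "b \<equiv> dB n u"
  defines "B \<equiv> image_mset (\<lambda>s. s div b) (Bbar n u)"
  shows "mgraph_iso (induced G (Vneg n b j)) (circ_del half_neg (n div b) B)"
    and "mgraph_iso (underlying (induced G (Vneg n b j))) (underlying (circ' (n div b) B))"
    and "half_neg = 1 \<Longrightarrow> mgraph_iso (induced G (Vneg n b j)) (circ' (n div b) B)"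
proof -
  have n0: "0 < n" using n2 by simp
  note bn = components_alternating(4)[OF Q refl refl]
  have inj: "inj (Neg :: nat \<Rightarrow> nat letter)" by (simp add: inj_def)
  have dvd: "dB n u dvd s" if "s \<in># Bbar' n u + replicate_mset half_neg h" for s
    unfolding dB_def using that Bbar_eq by (intro Gcd_dvd) simp
  note iso = circulant_component[where G = G, OF n_eq h_pos bn j inj dvd Vneg_eq[OF bn n0]
      filter_edges_Neg[OF Q, of "{i. i < n \<and> [i = j] (mod dB n u)}", folded Vneg_eq[OF bn n0]]]
  show "mgraph_iso (induced G (Vneg n b j)) (circ_del half_neg (n div b) B)"
    and "mgraph_iso (underlying (induced G (Vneg n b j))) (underlying (circ' (n div b) B))"
    and "half_neg = 1 \<Longrightarrow> mgraph_iso (induced G (Vneg n b j)) (circ' (n div b) B)"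
    using iso unfolding b_def B_def Bbar_eq by blast+
qed

text \<open>Representatives below the gcd lie in distinct residue classes, and the sign separates
  the two families.\<close>

lemma inj_on_components:
  assumes Q: "Qbar n u = {#}"
  shows "inj_on (\<lambda>j. induced G (Vpos n (dA n u) j)) {..<dA n u}"
    and "inj_on (\<lambda>j. induced G (Vneg n (dB n u) j)) {..<dB n u}"
    and "(\<lambda>j. induced G (Vpos n (dA n u) j)) ` {..<dA n u} \<inter>
      (\<lambda>j. induced G (Vneg n (dB n u) j)) ` {..<dB n u} = {}"
proof -
  have n0: "0 < n" using n2 by simp
  note an = components_alternating(2)[OF Q refl refl] and bn = components_alternating(4)[OF Q refl refl]
  show "inj_on (\<lambda>j. induced G (Vpos n (dA n u) j)) {..<dA n u}"
  proof (rule inj_onI)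
    fix i j assume ij: "i \<in> {..<dA n u}" "j \<in> {..<dA n u}"
      "induced G (Vpos n (dA n u) i) = induced G (Vpos n (dA n u) j)"
    then have "Vpos n (dA n u) i = Vpos n (dA n u) j" by (simp only: induced_eq_iff)
    moreover have "Pos i \<in> Vpos n (dA n u) i"
      using ij dvd_imp_le[OF an n0] by (simp add: Vpos_eq[OF an n0])
    ultimately have "[i = j] (mod dA n u)" by (auto simp: Vpos_eq[OF an n0])
    then show "i = j" using ij by (simp add: cong_less_modulus_unique_nat)
  qed
  show "inj_on (\<lambda>j. induced G (Vneg n (dB n u) j)) {..<dB n u}"
  proof (rule inj_onI)
    fix i j assume ij: "i \<in> {..<dB n u}" "j \<in> {..<dB n u}"
      "induced G (Vneg n (dB n u) i) = induced G (Vneg n (dB n u) j)"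
    then have "Vneg n (dB n u) i = Vneg n (dB n u) j" by (simp only: induced_eq_iff)
    moreover have "Neg i \<in> Vneg n (dB n u) i"
      using ij dvd_imp_le[OF bn n0] by (simp add: Vneg_eq[OF bn n0])
    ultimately have "[i = j] (mod dB n u)" by (auto simp: Vneg_eq[OF bn n0])
    then show "i = j" using ij by (simp add: cong_less_modulus_unique_nat)
  qed
  have "Vpos n (dA n u) i \<noteq> Vneg n (dB n u) j" if "i < dA n u" for i j
  proof -
    have "Pos i \<in> Vpos n (dA n u) i"
      using that dvd_imp_le[OF an n0] by (simp add: Vpos_eq[OF an n0])
    then show ?thesis by (auto simp: Vneg_eq[OF bn n0])
  qed
  then show "(\<lambda>j. induced G (Vpos n (dA n u) j)) ` {..<dA n u} \<inter>
      (\<lambda>j. induced G (Vneg n (dB n u) j)) ` {..<dB n u} = {}"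
    by (auto simp: induced_eq_iff)
qed

text \<open>The junction after \<open>u\<close> has the sign of its last letter and the other the
  sign opposite to its first; with equal end signs, each sign receives one half orbit.\<close>

lemma half_same: "positive (hd u) = positive (last u) \<Longrightarrow> half_pos = 1 \<and> half_neg = 1"
  by (simp add: half_pos_def half_neg_def)

lemma Abar_diff: "Abar n u - Abar' n u = replicate_mset half_pos h"
  and Bbar_diff: "Bbar n u - Bbar' n u = replicate_mset half_neg h"
  by (simp_all add: Abar_eq Bbar_eq)

lemma not_alternating_case:
  assumes q0: "q0 \<in># Qbar n u"
  shows "let d = dQ n u q0;
               \<Gamma>p = (\<lambda>j. induced G (Vpos n d j));
               \<Gamma>m = (\<lambda>j. induced G (Vneg n d (j + q0)));
               \<Gamma>c = (\<lambda>j. induced G (verts (\<Gamma>p j) \<union> verts (\<Gamma>m j)))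
           in card (components G) = d
            \<and> bij_betw \<Gamma>c {..<d} (components G)
            \<and> (\<forall>j<d. d dvd n \<and> card (verts (\<Gamma>p j)) = n div d \<and> card (verts (\<Gamma>m j)) = n div d)
            \<and> (\<forall>C\<in>components G. \<forall>i k.
                 (Pos i \<in> verts C \<and> Pos k \<in> verts C \<longrightarrow> [i = k] (mod d))
               \<and> (Neg i \<in> verts C \<and> Neg k \<in> verts C \<longrightarrow> [i = k] (mod d)))"
  unfolding Let_def verts_induced
proof (intro conjI)
  let ?d = "dQ n u q0"
  note c = components_not_alternating[OF q0 refl]
  have n0: "0 < n" using n2 by simp
  show bij: "bij_betw (\<lambda>j. induced G (Vpos n ?d j \<union> Vneg n ?d (j + q0))) {..<?d} (components G)"
    by (rule c(3))
  show "card (components G) = ?d" using bij_betw_same_card[OF bij] by simp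
  have "card (Vpos n ?d j) = n div ?d" "card (Vneg n ?d j) = n div ?d" for j
    unfolding Vpos_eq[OF c(2) n0] Vneg_eq[OF c(2) n0]
    by (simp_all add: card_image inj_on_def card_shift_class[OF c(2) n0])
  then show "\<forall>j<?d. ?d dvd n \<and> card (Vpos n ?d j) = n div ?d \<and> card (Vneg n ?d (j + q0)) = n div ?d"
    using c(2) by blast
  show "\<forall>C\<in>components G. \<forall>i k.
       (Pos i \<in> verts C \<and> Pos k \<in> verts C \<longrightarrow> [i = k] (mod ?d))
     \<and> (Neg i \<in> verts C \<and> Neg k \<in> verts C \<longrightarrow> [i = k] (mod ?d))"
  proof
    fix C assume "C \<in> components G"
    then obtain j where "C = induced G (Vpos n ?d j \<union> Vneg n ?d (j + q0))"
      using bij unfolding bij_betw_def by blast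
    then have "verts C = Vpos n ?d j \<union> Vneg n ?d (j + q0)" by simp
    then show "\<forall>i k.
       (Pos i \<in> verts C \<and> Pos k \<in> verts C \<longrightarrow> [i = k] (mod ?d))
     \<and> (Neg i \<in> verts C \<and> Neg k \<in> verts C \<longrightarrow> [i = k] (mod ?d))"
      unfolding Vpos_eq[OF c(2) n0] Vneg_eq[OF c(2) n0] by (auto simp: cong_def)
  qed
qed

lemma alternating_case:
  assumes "alternating u"
  shows "let a = dA n u; b = dB n u;
             \<Gamma>p = (\<lambda>j. induced G (Vpos n a j));
             \<Gamma>m = (\<lambda>j. induced G (Vneg n b j));
             A = image_mset (\<lambda>s. s div a) (Abar n u);
             B = image_mset (\<lambda>s. s div b) (Bbar n u)
         in card (components G) = a + b
          \<and> components G = \<Gamma>p ` {..<a} \<union> \<Gamma>m ` {..<b}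
          \<and> inj_on \<Gamma>p {..<a} \<and> inj_on \<Gamma>m {..<b} \<and> \<Gamma>p ` {..<a} \<inter> \<Gamma>m ` {..<b} = {}
          \<and> (\<forall>j<a. mgraph_iso (underlying (\<Gamma>p j)) (underlying (circ' (n div a) A)))
          \<and> (\<forall>j<b. mgraph_iso (underlying (\<Gamma>m j)) (underlying (circ' (n div b) B)))
          \<and> (if positive (hd u) \<longleftrightarrow> positive (last u)
              then (\<forall>j<a. mgraph_iso (\<Gamma>p j) (circ' (n div a) A))
                 \<and> (\<forall>j<b. mgraph_iso (\<Gamma>m j) (circ' (n div b) B))
              else (\<forall>j<a. mgraph_iso (\<Gamma>p j)
                      (circ_del (size (Abar n u - Abar' n u)) (n div a) A))
                 \<and> (\<forall>j<b. mgraph_iso (\<Gamma>m j)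
                      (circ_del (size (Bbar n u - Bbar' n u)) (n div b) B)))"
proof -
  note Q = alternating_imp_Qbar_empty[OF assms, of n]
  note comps = components_alternating(5)[OF Q refl refl]
  note inj = inj_on_components[OF Q]
  have "card (components G) = dA n u + dB n u"
    unfolding comps using inj by (simp add: card_Un_disjoint card_image)
  then show ?thesis
    unfolding Let_def Abar_diff Bbar_diff size_replicate_mset
    using comps inj component_iso_Pos[OF Q] component_iso_Neg[OF Q] half_same by (simp split: if_splits)
qed

end

theorem theorem5p7:
  fixes n :: nat and u w :: "nat word" and \<Gamma> :: "nat letter mgraph"
  assumes "n \<ge> 2" and "even n"
    and "u \<in> free_grp {..<n}" and "u \<noteq> []"
    and "w = fmul u (winv ((theta n ^^ (n div 2)) u))"
    and "\<not> proper_power {..<n} w"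
    and "\<Gamma> = star_graph (cyclic_pres n w)"
  shows
    "regular (length u) \<Gamma>
   \<and> verts \<Gamma> = {Pos i | i. i < n} \<union> {Neg i | i. i < n}
   \<and> edges \<Gamma> =
        shift_edges n n (Abar' n u) (\<lambda>i k. {Pos i, Pos k})
      + shift_edges n n (Bbar' n u) (\<lambda>i k. {Neg i, Neg k})
      + shift_edges n n (Qbar n u) (\<lambda>i k. {Pos i, Neg k})
      + shift_edges n (n div 2) (Abar n u - Abar' n u) (\<lambda>i k. {Pos i, Pos k})
      + shift_edges n (n div 2) (Bbar n u - Bbar' n u) (\<lambda>i k. {Neg i, Neg k})
   \<and> (\<not> alternating u \<longrightarrow>
        (\<forall>q0. q0 \<in># Qbar n u \<longrightarrow>
          (let d = dQ n u q0;
               \<Gamma>p = (\<lambda>j. induced \<Gamma> (Vpos n d j));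
               \<Gamma>m = (\<lambda>j. induced \<Gamma> (Vneg n d (j + q0)));
               \<Gamma>c = (\<lambda>j. induced \<Gamma> (verts (\<Gamma>p j) \<union> verts (\<Gamma>m j)))
           in card (components \<Gamma>) = d
            \<and> bij_betw \<Gamma>c {..<d} (components \<Gamma>)
            \<and> (\<forall>j<d. d dvd n \<and> card (verts (\<Gamma>p j)) = n div d \<and> card (verts (\<Gamma>m j)) = n div d)
            \<and> (\<forall>C\<in>components \<Gamma>. \<forall>i k.
                 (Pos i \<in> verts C \<and> Pos k \<in> verts C \<longrightarrow> [i = k] (mod d))
               \<and> (Neg i \<in> verts C \<and> Neg k \<in> verts C \<longrightarrow> [i = k] (mod d))))))
   \<and> (alternating u \<longrightarrow>
        (let a = dA n u; b = dB n u;
             \<Gamma>p = (\<lambda>j. induced \<Gamma> (Vpos n a j));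
             \<Gamma>m = (\<lambda>j. induced \<Gamma> (Vneg n b j));
             A = image_mset (\<lambda>s. s div a) (Abar n u);
             B = image_mset (\<lambda>s. s div b) (Bbar n u)
         in card (components \<Gamma>) = a + b
          \<and> components \<Gamma> = \<Gamma>p ` {..<a} \<union> \<Gamma>m ` {..<b}
          \<and> inj_on \<Gamma>p {..<a} \<and> inj_on \<Gamma>m {..<b} \<and> \<Gamma>p ` {..<a} \<inter> \<Gamma>m ` {..<b} = {}
          \<and> (\<forall>j<a. mgraph_iso (underlying (\<Gamma>p j)) (underlying (circ' (n div a) A)))
          \<and> (\<forall>j<b. mgraph_iso (underlying (\<Gamma>m j)) (underlying (circ' (n div b) B)))
          \<and> (if positive (hd u) \<longleftrightarrow> positive (last u)
              then (\<forall>j<a. mgraph_iso (\<Gamma>p j) (circ' (n div a) A))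
                 \<and> (\<forall>j<b. mgraph_iso (\<Gamma>m j) (circ' (n div b) B))
              else (\<forall>j<a. mgraph_iso (\<Gamma>p j)
                      (circ_del (size (Abar n u - Abar' n u)) (n div a) A))
                 \<and> (\<forall>j<b. mgraph_iso (\<Gamma>m j)
                      (circ_del (size (Bbar n u - Bbar' n u)) (n div b) B)))))"
proof -
  interpret star_word n "n div 2" u w
    using assms by unfold_locales auto
  have verts: "verts G = {Pos i | i. i < n} \<union> {Neg i | i. i < n}"
    using verts_G by auto
  show ?thesis
    unfolding assms(7)
    by (intro conjI impI allI regular_star_graph verts not_alternating_case alternating_case
        edges_formula[folded Abar_diff Bbar_diff]; assumption)
qed

end
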